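(* Let $S$ be an inverse semigroup such that its set of idempotents $E(S)$ is uniformly locally finite. Then the following are equivalent: (i) $\ell^{1}(S)$ has an ultra central approximate identity; (ii) each $\mathfrak{D}$-class of $S$ has finitely many idempotent elements.
   Context: A semigroup $S$ is an inverse semigroup if for every $s\in S$ there exists a unique $s^{*}\in S$ such that $ss^{*}s=s$ and $s^{*}ss^{*}=s^{*}$. $E(S)$ denotes the set of idempotents of $S$, partially ordered by $s\leq t \Longleftrightarrow s=st=ts$ ($s,t\in E(S)$). $E(S)$ is called uniformly locally finite if $\sup\{|\{f\in E(S): f\leq e\}| : e\in E(S)\}<\infty$. The equivalence relation $\mathfrak{D}$ on $S$ is defined by: $s\,\mathfrak{D}\,t$ if and only if there exists $x\in S$ such that $ss^{*}=xx^{*}$ and $t^{*}t=x^{*}x$. The $\mathfrak{D}$-classes are its equivalence classes. $\ell^{1}(S)$ is the semigroup algebra of $S$: the Banach space of absolutely summable functions $S\to\mathbb{C}$ with the convolution product determined by $\delta_{s}\ast\delta_{t}=\delta_{st}$. For a Banach algebra $A$ and a Banach $A$-bimodule $X$, the dual $X^{*}$ is a Banach $A$-bimodule via $(a\cdot f)(x)=f(x\cdot a)$ and $(f\cdot a)(x)=f(a\cdot x)$ for $a\in A$, $x\in X$, $f\in X^{*}$. In particular $A^{**}$ is a Banach $A$-bimodule, and $A$ is regarded as a subspace of $A^{**}$ via the canonical embedding. A Banach algebra $A$ has an ultra central approximate identity if there exists a net $(e_{\alpha})$ in $A^{**}$ such that $ae_{\alpha}=e_{\alpha}a$ for every $\alpha$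 and $e_{\alpha}a\rightarrow a$ (in the norm of $A^{**}$), for every $a\in A$. The net is not required to be bounded. *)

theory Defs
  imports "HOL-Analysis.Analysis"
begin

section \<open>Inverse semigroups\<close>

class inverse_semigroup = semigroup_mult +
  assumes ex1_generalized_inverse: "\<exists>!t. s * t * s = s \<and> t * s * t = t"

definition star :: "'s::inverse_semigroup \<Rightarrow> 's"
  where "star s = (THE t. s * t * s = s \<and> t * s * t = t)"

definition idempotents :: "'s::semigroup_mult set"
  where "idempotents = {e. e * e = e}"

definition idem_le :: "'s::semigroup_mult \<Rightarrow> 's \<Rightarrow> bool"
  where "idem_le s t \<longleftrightarrow> s = s * t \<and> s = t * s"

definition idempotents_uniformly_locally_finite :: "'s::semigroup_mult itself \<Rightarrow> bool"
  where "idempotents_uniformly_locally_finite _ \<longleftrightarrow>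
    (\<exists>N. \<forall>e\<in>idempotents :: 's set.
       finite {f \<in> idempotents. idem_le f e} \<and> card {f \<in> idempotents. idem_le f e} \<le> N)"

definition D_rel :: "('s::inverse_semigroup \<times> 's) set"
  where "D_rel = {(s, t). \<exists>x. s * star s = x * star x \<and> star t * t = star x * x}"

definition D_classes :: "'s::inverse_semigroup set set"
  where "D_classes = UNIV // D_rel"

lemma star_laws:
  fixes s :: "'s::inverse_semigroup"
  shows "s * star s * s = s" "star s * s * star s = star s"
  using theI'[OF ex1_generalized_inverse[of s]] unfolding star_def by auto


section \<open>Complex normed spaces and complex Banach algebras\<close>

text \<open>The library's normed spaces and algebras are real; the following classes add a
  compatible multiplication by complex scalars.\<close>

class scaleC =
  fixes scaleC :: "complex \<Rightarrow> 'a \<Rightarrow> 'a" (infixr "*\<^sub>C" 75)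

class complex_normed_vector = real_normed_vector + scaleC +
  assumes scaleC_add_right: "c *\<^sub>C (x + y) = c *\<^sub>C x + c *\<^sub>C y"
    and scaleC_add_left: "(c + d) *\<^sub>C x = c *\<^sub>C x + d *\<^sub>C x"
    and scaleC_scaleC: "c *\<^sub>C d *\<^sub>C x = (c * d) *\<^sub>C x"
    and scaleC_of_real: "complex_of_real r *\<^sub>C x = r *\<^sub>R x"
    and norm_scaleC: "norm (c *\<^sub>C x) = cmod c * norm x"

class complex_banach = complex_normed_vector + banach

class complex_banach_algebra = complex_banach + real_normed_algebra +
  assumes mult_scaleC_left: "(c *\<^sub>C x) * y = c *\<^sub>C (x * y)"
    and mult_scaleC_right: "x * (c *\<^sub>C y) = c *\<^sub>C (x * y)"


section \<open>The dual space\<close>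

typedef (overloaded) 'a cdual =
  "{f :: 'a::complex_normed_vector \<Rightarrow> complex.
      bounded_linear f \<and> (\<forall>c x. f (c *\<^sub>C x) = c * f x)}"
  morphisms cdual_apply Abs_cdual
  by (rule exI[of _ "\<lambda>_. 0"]) auto

setup_lifting type_definition_cdual

lemma cdual_eqI: "(\<And>x. cdual_apply f x = cdual_apply g x) \<Longrightarrow> f = g"
  by transfer auto

lemma bounded_linear_cdual_apply: "bounded_linear (cdual_apply f)"
  using cdual_apply[of f] by auto

lemma cdual_apply_scaleC: "cdual_apply f (c *\<^sub>C x) = c * cdual_apply f x"
  using cdual_apply[of f] by auto

instantiation cdual :: (complex_normed_vector) complex_normed_vector
begin

lift_definition norm_cdual :: "'a cdual \<Rightarrow> real" is onorm .

lift_definition minus_cdual :: "'a cdual \<Rightarrow> 'a cdual \<Rightarrow> 'a cdual" is "\<lambda>f g x. f x - g x"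
  by (auto simp: bounded_linear_sub algebra_simps)

definition dist_cdual :: "'a cdual \<Rightarrow> 'a cdual \<Rightarrow> real"
  where "dist_cdual f g = norm (f - g)"

definition uniformity_cdual :: "('a cdual \<times> 'a cdual) filter"
  where "uniformity_cdual = (INF e\<in>{0 <..}. principal {(x, y). dist x y < e})"

definition open_cdual :: "'a cdual set \<Rightarrow> bool"
  where "open_cdual S = (\<forall>x\<in>S. \<forall>\<^sub>F (x', y) in uniformity. x' = x \<longrightarrow> y \<in> S)"

lift_definition uminus_cdual :: "'a cdual \<Rightarrow> 'a cdual" is "\<lambda>f x. - f x"
  by (auto simp: bounded_linear_minus)

lift_definition zero_cdual :: "'a cdual" is "\<lambda>x. 0"
  by auto

lift_definition plus_cdual :: "'a cdual \<Rightarrow> 'a cdual \<Rightarrow> 'a cdual" is "\<lambda>f g x. f x + g x"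
  by (auto simp: bounded_linear_add algebra_simps)

lift_definition scaleR_cdual :: "real \<Rightarrow> 'a cdual \<Rightarrow> 'a cdual" is "\<lambda>r f x. r *\<^sub>R f x"
  by (auto intro: bounded_linear_compose[OF bounded_linear_scaleR_right])

lift_definition scaleC_cdual :: "complex \<Rightarrow> 'a cdual \<Rightarrow> 'a cdual" is "\<lambda>c f x. c * f x"
  by (auto intro: bounded_linear_compose[OF bounded_linear_mult_right])

definition sgn_cdual :: "'a cdual \<Rightarrow> 'a cdual"
  where "sgn_cdual f = inverse (norm f) *\<^sub>R f"

lemma onorm_mult_left_complex:
  assumes "bounded_linear (f :: 'b::real_normed_vector \<Rightarrow> complex)"
  shows "onorm (\<lambda>x. c * f x) = cmod c * onorm f"
proof -
  have le: "onorm (\<lambda>x. c * g x) \<le> cmod c * onorm g"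
    if "bounded_linear g" for c and g :: "'b \<Rightarrow> complex"
  proof (rule onorm_bound)
    show "0 \<le> cmod c * onorm g" by (simp add: onorm_pos_le that)
    show "cmod (c * g x) \<le> cmod c * onorm g * norm x" for x
      using mult_left_mono[OF onorm[OF that, of x], of "cmod c"]
      by (simp add: norm_mult mult.assoc)
  qed
  show ?thesis
  proof (cases "c = 0")
    case True
    then show ?thesis by (simp add: onorm_zero)
  next
    case False
    have bl: "bounded_linear (\<lambda>x. c * f x)"
      using bounded_linear_compose[OF bounded_linear_mult_right assms] .
    have "onorm f = onorm (\<lambda>x. inverse c * (c * f x))"
      using False by (simp add: mult.assoc[symmetric])
    also have "\<dots> \<le> cmod (inverse c) * onorm (\<lambda>x. c * f x)"
      by (rule le[OF bl])
    finally have "cmod c * onorm f \<le> onorm (\<lambda>x. c * f x)"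
      using False by (simp add: norm_divide field_simps)
    with le[OF assms] show ?thesis by (simp add: order_antisym)
  qed
qed

instance
proof
  fix f g h :: "'a cdual" and r s :: real and c d :: complex
  show "f + g + h = f + (g + h)" by transfer (simp add: add.assoc)
  show "f + g = g + f" by transfer (simp add: add.commute)
  show "0 + f = f" by transfer simp
  show "- f + f = 0" by transfer simp
  show "f - g = f + - g" by transfer simp
  show "r *\<^sub>R (f + g) = r *\<^sub>R f + r *\<^sub>R g" by transfer (simp add: algebra_simps)
  show "(r + s) *\<^sub>R f = r *\<^sub>R f + s *\<^sub>R f" by transfer (simp add: algebra_simps)
  show "r *\<^sub>R s *\<^sub>R f = (r * s) *\<^sub>R f" by transfer simp
  show "1 *\<^sub>R f = f" by transfer simp
  show "dist f g = norm (f - g)" by (rule dist_cdual_def)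
  show "sgn f = inverse (norm f) *\<^sub>R f" by (rule sgn_cdual_def)
  show "uniformity = (INF e\<in>{0 <..}. principal {(x :: 'a cdual, y). dist x y < e})"
    by (rule uniformity_cdual_def)
  show "open U = (\<forall>x\<in>U. \<forall>\<^sub>F (x', y) in uniformity. x' = x \<longrightarrow> y \<in> U)"
    for U :: "'a cdual set" by (rule open_cdual_def)
  show "norm f = 0 \<longleftrightarrow> f = 0" by transfer (auto simp: onorm_eq_0)
  show "norm (f + g) \<le> norm f + norm g" by transfer (simp add: onorm_triangle)
  show "norm (r *\<^sub>R f) = \<bar>r\<bar> * norm f" by transfer (simp add: onorm_scaleR)
  show "c *\<^sub>C (f + g) = c *\<^sub>C f + c *\<^sub>C g" by transfer (simp add: algebra_simps)
  show "(c + d) *\<^sub>C f = c *\<^sub>C f + d *\<^sub>C f" by transfer (simp add: algebra_simps)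
  show "c *\<^sub>C d *\<^sub>C f = (c * d) *\<^sub>C f" by transfer (simp add: mult.assoc)
  show "complex_of_real r *\<^sub>C f = r *\<^sub>R f" by transfer (simp add: scaleR_conv_of_real)
  show "norm (c *\<^sub>C f) = cmod c * norm f" by transfer (simp add: onorm_mult_left_complex)
qed

end

lemma norm_cdual_apply: "cmod (cdual_apply f x) \<le> norm f * norm x"
  by transfer (simp add: onorm)

lemma norm_cdual_bound:
  "0 \<le> b \<Longrightarrow> (\<And>x. cmod (cdual_apply f x) \<le> b * norm x) \<Longrightarrow> norm f \<le> b"
  by transfer (auto intro: onorm_bound)

lift_definition blinfun_of_cdual :: "'a::complex_normed_vector cdual \<Rightarrow> 'a \<Rightarrow>\<^sub>L complex"
  is "\<lambda>f. f" by auto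

instance cdual :: (complex_normed_vector) complex_banach
proof
  fix X :: "nat \<Rightarrow> 'a cdual"
  assume "Cauchy X"
  have nrm: "norm (blinfun_of_cdual f - blinfun_of_cdual g) = norm (f - g)" for f g :: "'a cdual"
    by transfer simp
  have ap: "blinfun_apply (blinfun_of_cdual f) = cdual_apply f" for f :: "'a cdual"
    by transfer simp
  have "Cauchy (\<lambda>n. blinfun_of_cdual (X n))"
    using \<open>Cauchy X\<close> unfolding Cauchy_def dist_norm nrm .
  then obtain L where L: "(\<lambda>n. blinfun_of_cdual (X n)) \<longlonglongrightarrow> L"
    using Cauchy_convergent convergent_def by blast
  have lim: "(\<lambda>n. cdual_apply (X n) x) \<longlonglongrightarrow> blinfun_apply L x" for x
    using blinfun.tendsto[OF L tendsto_const[of x]] by (simp add: ap)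
  have "blinfun_apply L (c *\<^sub>C x) = c * blinfun_apply L x" for c x
    using LIMSEQ_unique[OF lim[of "c *\<^sub>C x"]] tendsto_mult_left[OF lim[of x], of c]
    by (simp add: cdual_apply_scaleC)
  then have mem: "blinfun_apply L \<in> {f. bounded_linear f \<and> (\<forall>c x. f (c *\<^sub>C x) = c * f x)}"
    by (simp add: blinfun.bounded_linear_right)
  define g where "g = Abs_cdual (blinfun_apply L)"
  have "blinfun_of_cdual g = L"
    by (rule blinfun_eqI) (simp add: ap g_def Abs_cdual_inverse[OF mem])
  then have "norm (X n - g) = norm (blinfun_of_cdual (X n) - L)" for n
    using nrm[of "X n" g] by simp
  then have "X \<longlonglongrightarrow> g"
    using L by (simp add: tendsto_iff dist_norm)
  then show "convergent X" by (auto simp: convergent_def)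
qed

lift_definition canonical_embedding :: "'a::complex_normed_vector \<Rightarrow> 'a cdual cdual"
  is "\<lambda>x f. cdual_apply f x"
proof (intro conjI allI)
  fix x :: 'a
  show "bounded_linear (\<lambda>f. cdual_apply f x)"
  proof (rule bounded_linear_intro[of _ "norm x"])
    show "cdual_apply (f + g) x = cdual_apply f x + cdual_apply g x" for f g
      by transfer simp
    show "cdual_apply (r *\<^sub>R f) x = r *\<^sub>R cdual_apply f x" for r f
      by transfer simp
    show "cmod (cdual_apply f x) \<le> norm f * norm x" for f
      by (rule norm_cdual_apply)
  qed
  show "cdual_apply (c *\<^sub>C f) x = c * cdual_apply f x" for c f
    by transfer simp
qed


section \<open>Banach bimodules and their duals\<close>

definition bounded_cbilinear ::
    "('a::complex_normed_vector \<Rightarrow> 'b::complex_normed_vector \<Rightarrow> 'c::complex_normed_vector) \<Rightarrow> bool"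
  where "bounded_cbilinear B \<longleftrightarrow> bounded_bilinear B \<and>
    (\<forall>c a b. B (c *\<^sub>C a) b = c *\<^sub>C B a b \<and> B a (c *\<^sub>C b) = c *\<^sub>C B a b)"

definition banach_bimodule ::
    "('a::complex_banach_algebra \<Rightarrow> 'x::complex_banach \<Rightarrow> 'x) \<Rightarrow> ('x \<Rightarrow> 'a \<Rightarrow> 'x) \<Rightarrow> bool"
  where "banach_bimodule l r \<longleftrightarrow> bounded_cbilinear l \<and> bounded_cbilinear r \<and>
    (\<forall>a b x. l (a * b) x = l a (l b x)) \<and>
    (\<forall>a b x. r x (a * b) = r (r x a) b) \<and>
    (\<forall>a b x. l a (r x b) = r (l a x) b)"

text \<open>The two actions on the dual of a bimodule with left action \<open>l\<close> and right action \<open>r\<close>: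
  \<open>(a \<cdot> f) x = f (x \<cdot> a)\<close> and \<open>(f \<cdot> a) x = f (a \<cdot> x)\<close>. So the left action is obtained from
  \<open>r\<close> and the right action from \<open>l\<close>.\<close>

definition dual_left_action ::
    "('x::complex_normed_vector \<Rightarrow> 'a \<Rightarrow> 'x) \<Rightarrow> 'a \<Rightarrow> 'x cdual \<Rightarrow> 'x cdual"
  where "dual_left_action r a f = Abs_cdual (\<lambda>x. cdual_apply f (r x a))"

definition dual_right_action ::
    "('a \<Rightarrow> 'x::complex_normed_vector \<Rightarrow> 'x) \<Rightarrow> 'x cdual \<Rightarrow> 'a \<Rightarrow> 'x cdual"
  where "dual_right_action l f a = Abs_cdual (\<lambda>x. cdual_apply f (l a x))"

lemma apply_dual_left_action:
  assumes "bounded_cbilinear r"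
  shows "cdual_apply (dual_left_action r a f) x = cdual_apply f (r x a)"
proof -
  have "bounded_linear (\<lambda>x. cdual_apply f (r x a))"
    using assms unfolding bounded_cbilinear_def
    by (intro bounded_linear_compose[OF bounded_linear_cdual_apply]
        bounded_bilinear.bounded_linear_left) auto
  moreover have "cdual_apply f (r (c *\<^sub>C x) a) = c * cdual_apply f (r x a)" for c x
    using assms by (simp add: bounded_cbilinear_def cdual_apply_scaleC)
  ultimately show ?thesis
    unfolding dual_left_action_def by (subst Abs_cdual_inverse) auto
qed

lemma apply_dual_right_action:
  assumes "bounded_cbilinear l"
  shows "cdual_apply (dual_right_action l f a) x = cdual_apply f (l a x)"
proof -
  have "bounded_linear (\<lambda>x. cdual_apply f (l a x))"
    using assms unfolding bounded_cbilinear_def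
    by (intro bounded_linear_compose[OF bounded_linear_cdual_apply]
        bounded_bilinear.bounded_linear_right) auto
  moreover have "cdual_apply f (l a (c *\<^sub>C x)) = c * cdual_apply f (l a x)" for c x
    using assms by (simp add: bounded_cbilinear_def cdual_apply_scaleC)
  ultimately show ?thesis
    unfolding dual_right_action_def by (subst Abs_cdual_inverse) auto
qed

lemma cdual_apply_plus: "cdual_apply (f + g) x = cdual_apply f x + cdual_apply g x"
  and cdual_apply_scaleR_left: "cdual_apply (r *\<^sub>R f) x = r *\<^sub>R cdual_apply f x"
  and cdual_apply_scaleC_left: "cdual_apply (c *\<^sub>C f) x = c * cdual_apply f x"
  by (transfer, simp)+

lemma cdual_apply_add: "cdual_apply f (x + y) = cdual_apply f x + cdual_apply f y"
  and cdual_apply_scaleR: "cdual_apply f (r *\<^sub>R x) = r *\<^sub>R cdual_apply f x"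
  using bounded_linear_cdual_apply[of f]
  by (simp_all add: linear_add linear_cmul bounded_linear.linear)

lemma bounded_cbilinear_dual_left_action:
  assumes r: "bounded_cbilinear r"
  shows "bounded_cbilinear (dual_left_action r)"
proof -
  note ap = apply_dual_left_action[OF r]
  interpret r: bounded_bilinear r using r by (simp add: bounded_cbilinear_def)
  obtain K where K: "0 \<le> K" "\<And>x a. norm (r x a) \<le> norm x * norm a * K"
    using r.nonneg_bounded by blast
  have "norm (dual_left_action r a f) \<le> norm a * norm f * K" for a f
  proof (rule norm_cdual_bound)
    show "0 \<le> norm a * norm f * K" using K(1) by simp
    fix x
    have "cmod (cdual_apply f (r x a)) \<le> norm f * norm (r x a)" by (rule norm_cdual_apply)
    also have "\<dots> \<le> norm f * (norm x * norm a * K)"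
      by (intro mult_left_mono K(2)) simp
    finally show "cmod (cdual_apply (dual_left_action r a f) x) \<le> norm a * norm f * K * norm x"
      by (simp add: ap mult_ac)
  qed
  then have "\<exists>K. \<forall>a f. norm (dual_left_action r a f) \<le> norm a * norm f * K" by blast
  then have "bounded_bilinear (dual_left_action r)"
    by unfold_locales
      (auto intro!: cdual_eqI simp: ap cdual_apply_plus cdual_apply_scaleR_left
        cdual_apply_add cdual_apply_scaleR r.add_right r.scaleR_right)
  then show ?thesis using r unfolding bounded_cbilinear_def
    by (auto intro!: cdual_eqI simp: ap r cdual_apply_scaleC_left cdual_apply_scaleC)
qed

lemma bounded_cbilinear_dual_right_action:
  assumes l: "bounded_cbilinear l"
  shows "bounded_cbilinear (dual_right_action l)"
proof -
  note ap = apply_dual_right_action[OF l]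
  interpret l: bounded_bilinear l using l by (simp add: bounded_cbilinear_def)
  obtain K where K: "0 \<le> K" "\<And>a x. norm (l a x) \<le> norm a * norm x * K"
    using l.nonneg_bounded by blast
  have "norm (dual_right_action l f a) \<le> norm f * norm a * K" for a f
  proof (rule norm_cdual_bound)
    show "0 \<le> norm f * norm a * K" using K(1) by simp
    fix x
    have "cmod (cdual_apply f (l a x)) \<le> norm f * norm (l a x)" by (rule norm_cdual_apply)
    also have "\<dots> \<le> norm f * (norm a * norm x * K)"
      by (intro mult_left_mono K(2)) simp
    finally show "cmod (cdual_apply (dual_right_action l f a) x) \<le> norm f * norm a * K * norm x"
      by (simp add: ap mult_ac)
  qed
  then have "\<exists>K. \<forall>f a. norm (dual_right_action l f a) \<le> norm f * norm a * K" by blast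
  then have "bounded_bilinear (dual_right_action l)"
    by unfold_locales
      (auto intro!: cdual_eqI simp: ap cdual_apply_plus cdual_apply_scaleR_left
        cdual_apply_add cdual_apply_scaleR l.add_left l.scaleR_left)
  then show ?thesis using l unfolding bounded_cbilinear_def
    by (auto intro!: cdual_eqI simp: ap l cdual_apply_scaleC_left cdual_apply_scaleC)
qed

lemma banach_bimodule_dual:
  assumes "banach_bimodule l r"
  shows "banach_bimodule (dual_left_action r) (dual_right_action l)"
proof -
  have l: "bounded_cbilinear l" and r: "bounded_cbilinear r"
    using assms by (auto simp: banach_bimodule_def)
  show ?thesis
    using assms unfolding banach_bimodule_def
    by (auto intro!: cdual_eqI bounded_cbilinear_dual_left_action
        bounded_cbilinear_dual_right_action
        simp: apply_dual_left_action[OF r] apply_dual_right_action[OF l])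
qed

lemma banach_bimodule_times:
  "banach_bimodule ((*) :: 'a::complex_banach_algebra \<Rightarrow> 'a \<Rightarrow> 'a) (*)"
  by (auto simp: banach_bimodule_def bounded_cbilinear_def bounded_bilinear_mult
      mult_scaleC_left mult_scaleC_right mult.assoc)

definition bidual_left_action ::
    "'a::complex_banach_algebra \<Rightarrow> 'a cdual cdual \<Rightarrow> 'a cdual cdual"
  where "bidual_left_action = dual_left_action (dual_right_action (*))"

definition bidual_right_action ::
    "'a::complex_banach_algebra cdual cdual \<Rightarrow> 'a \<Rightarrow> 'a cdual cdual"
  where "bidual_right_action = dual_right_action (dual_left_action (*))"

lemma banach_bimodule_bidual: "banach_bimodule bidual_left_action bidual_right_action"
  unfolding bidual_left_action_def bidual_right_action_def
  by (intro banach_bimodule_dual banach_bimodule_times)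


section \<open>Ultra central approximate identities\<close>

definition directed_preorder :: "'i set \<Rightarrow> ('i \<Rightarrow> 'i \<Rightarrow> bool) \<Rightarrow> bool"
  where "directed_preorder I le \<longleftrightarrow> I \<noteq> {} \<and> (\<forall>i\<in>I. le i i) \<and>
    (\<forall>i\<in>I. \<forall>j\<in>I. \<forall>k\<in>I. le i j \<longrightarrow> le j k \<longrightarrow> le i k) \<and>
    (\<forall>i\<in>I. \<forall>j\<in>I. \<exists>k\<in>I. le i k \<and> le j k)"

definition net_tendsto ::
    "'i set \<Rightarrow> ('i \<Rightarrow> 'i \<Rightarrow> bool) \<Rightarrow> ('i \<Rightarrow> 'b::real_normed_vector) \<Rightarrow> 'b \<Rightarrow> bool"
  where "net_tendsto I le x y \<longleftrightarrow>
    (\<forall>\<epsilon>>0. \<exists>i\<in>I. \<forall>j\<in>I. le i j \<longrightarrow> norm (x j - y) < \<epsilon>)"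

definition ultra_central_approximate_identity ::
    "'i set \<Rightarrow> ('i \<Rightarrow> 'i \<Rightarrow> bool) \<Rightarrow> ('i \<Rightarrow> 'a::complex_banach_algebra cdual cdual) \<Rightarrow> bool"
  where "ultra_central_approximate_identity I le e \<longleftrightarrow> directed_preorder I le \<and>
    (\<forall>a. \<forall>i\<in>I. bidual_left_action a (e i) = bidual_right_action (e i) a) \<and>
    (\<forall>a. net_tendsto I le (\<lambda>i. bidual_right_action (e i) a) (canonical_embedding a))"

text \<open>A definition cannot quantify over all index types, so nets are taken over subsets of one
  fixed type, which is large enough: by lemma \<open>has_ultra_central_approximate_identityI\<close> below, a
  net over an arbitrary index type yields one over this type.\<close>

definition has_ultra_central_approximate_identity :: "'a::complex_banach_algebra itself \<Rightarrow> bool"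
  where "has_ultra_central_approximate_identity _ \<longleftrightarrow>
    (\<exists>(I :: ('a cdual cdual \<times> 'a cdual cdual set) set) le (e :: _ \<Rightarrow> 'a cdual cdual).
       ultra_central_approximate_identity I le e)"

lemma has_ultra_central_approximate_identityI:
  fixes I :: "'i set" and e :: "'i \<Rightarrow> 'a::complex_banach_algebra cdual cdual"
  assumes "ultra_central_approximate_identity I le e"
  shows "has_ultra_central_approximate_identity TYPE('a)"
proof -
  have ne: "I \<noteq> {}" and rfl: "\<And>i. i \<in> I \<Longrightarrow> le i i"
    and tr: "\<And>i j k. i \<in> I \<Longrightarrow> j \<in> I \<Longrightarrow> k \<in> I \<Longrightarrow> le i j \<Longrightarrow> le j k \<Longrightarrow> le i k"
    and ub: "\<And>i j. i \<in> I \<Longrightarrow> j \<in> I \<Longrightarrow> \<exists>k\<in>I. le i k \<and> le j k"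
    and cen: "\<And>a i. i \<in> I \<Longrightarrow> bidual_left_action a (e i) = bidual_right_action (e i) a"
    and lim: "\<And>a. net_tendsto I le (\<lambda>i. bidual_right_action (e i) a) (canonical_embedding a)"
    using assms unfolding ultra_central_approximate_identity_def directed_preorder_def by blast+
  define tail where "tail i = e ` {j \<in> I. le i j}" for i
  define J where "J = {(x, U). x \<in> U \<and> (\<exists>i\<in>I. U = tail i)}"
  define le' where "le' p q \<longleftrightarrow> snd q \<subseteq> snd p" for p q :: "'a cdual cdual \<times> 'a cdual cdual set"
  have mem: "(e i, tail i) \<in> J" if "i \<in> I" for i
    using that rfl by (auto simp: J_def tail_def)
  have inI: "\<exists>i\<in>I. fst p = e i" if "p \<in> J" for p
    using that by (auto simp: J_def tail_def)
  have mono: "tail k \<subseteq> tail i" if "i \<in> I" "k \<in> I" "le i k" for i k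
    unfolding tail_def using that tr by blast
  have "directed_preorder J le'"
    unfolding directed_preorder_def
  proof (intro conjI ballI impI)
    show "J \<noteq> {}" using ne mem by blast
    fix p q assume "p \<in> J" "q \<in> J"
    then obtain i j where ij: "i \<in> I" "snd p = tail i" "j \<in> I" "snd q = tail j"
      by (auto simp: J_def)
    then obtain k where "k \<in> I" "le i k" "le j k" using ub by blast
    then show "\<exists>s\<in>J. le' p s \<and> le' q s"
      using ij mem mono by (intro bexI[of _ "(e k, tail k)"]) (auto simp: le'_def)
  qed (auto simp: le'_def)
  moreover have "bidual_left_action a (fst p) = bidual_right_action (fst p) a" if "p \<in> J" for a p
    using inI[OF that] cen by auto
  moreover have "net_tendsto J le' (\<lambda>p. bidual_right_action (fst p) a) (canonical_embedding a)" for a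
    unfolding net_tendsto_def
  proof (intro allI impI)
    fix \<epsilon> :: real assume "\<epsilon> > 0"
    then obtain i where i: "i \<in> I"
      "\<And>j. j \<in> I \<Longrightarrow> le i j \<Longrightarrow> norm (bidual_right_action (e j) a - canonical_embedding a) < \<epsilon>"
      using lim[of a] unfolding net_tendsto_def by blast
    show "\<exists>p\<in>J. \<forall>q\<in>J. le' p q \<longrightarrow>
        norm (bidual_right_action (fst q) a - canonical_embedding a) < \<epsilon>"
    proof (intro bexI[OF _ mem[OF i(1)]] ballI impI)
      fix q assume "q \<in> J" "le' (e i, tail i) q"
      then have "fst q \<in> tail i" by (auto simp: J_def le'_def)
      then show "norm (bidual_right_action (fst q) a - canonical_embedding a) < \<epsilon>"
        using i(2) by (auto simp: tail_def)
    qed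
  qed
  ultimately have "ultra_central_approximate_identity J le' fst"
    unfolding ultra_central_approximate_identity_def by blast
  then show ?thesis
    unfolding has_ultra_central_approximate_identity_def by blast
qed


section \<open>The semigroup algebra\<close>

no_notation Infinite_Set_Sum.abs_summable_on (infix "abs'_summable'_on" 50)

typedef 's ell1 = "{f :: 's \<Rightarrow> complex. f abs_summable_on UNIV}"
  morphisms ell1_apply Abs_ell1
  by (rule exI[of _ "\<lambda>_. 0"]) auto

setup_lifting type_definition_ell1

lemma ell1_eqI: "(\<And>s. ell1_apply f s = ell1_apply g s) \<Longrightarrow> f = g"
  by transfer auto

lemma ell1_abs_summable: "ell1_apply f abs_summable_on UNIV"
  using ell1_apply[of f] by simp

lemma abs_summable_add:
  fixes f g :: "'s \<Rightarrow> complex"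
  assumes "f abs_summable_on A" "g abs_summable_on A"
  shows "(\<lambda>x. f x + g x) abs_summable_on A"
  by (rule Infinite_Sum.abs_summable_on_comparison_test'[OF summable_on_add[OF assms]])
    (rule norm_triangle_ineq)

lemma abs_summable_cmult:
  fixes f :: "'s \<Rightarrow> complex"
  assumes "f abs_summable_on A"
  shows "(\<lambda>x. c * f x) abs_summable_on A"
  by (simp add: norm_mult summable_on_cmult_right[OF assms])

instantiation ell1 :: (type) complex_normed_vector
begin

lift_definition norm_ell1 :: "'a ell1 \<Rightarrow> real" is "\<lambda>f. \<Sum>\<^sub>\<infinity>s. cmod (f s)" .

lift_definition zero_ell1 :: "'a ell1" is "\<lambda>_. 0" by simp

lift_definition plus_ell1 :: "'a ell1 \<Rightarrow> 'a ell1 \<Rightarrow> 'a ell1" is "\<lambda>f g s. f s + g s"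
  by (rule abs_summable_add)

lift_definition uminus_ell1 :: "'a ell1 \<Rightarrow> 'a ell1" is "\<lambda>f s. - f s" by simp

lift_definition minus_ell1 :: "'a ell1 \<Rightarrow> 'a ell1 \<Rightarrow> 'a ell1" is "\<lambda>f g s. f s - g s"
  using abs_summable_add[of _ _ "\<lambda>s. - _ s"] by simp

lift_definition scaleC_ell1 :: "complex \<Rightarrow> 'a ell1 \<Rightarrow> 'a ell1" is "\<lambda>c f s. c * f s"
  by (rule abs_summable_cmult)

definition scaleR_ell1 :: "real \<Rightarrow> 'a ell1 \<Rightarrow> 'a ell1"
  where "scaleR_ell1 r f = complex_of_real r *\<^sub>C f"

definition dist_ell1 :: "'a ell1 \<Rightarrow> 'a ell1 \<Rightarrow> real"
  where "dist_ell1 f g = norm (f - g)"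

definition uniformity_ell1 :: "('a ell1 \<times> 'a ell1) filter"
  where "uniformity_ell1 = (INF e\<in>{0 <..}. principal {(x, y). dist x y < e})"

definition open_ell1 :: "'a ell1 set \<Rightarrow> bool"
  where "open_ell1 S = (\<forall>x\<in>S. \<forall>\<^sub>F (x', y) in uniformity. x' = x \<longrightarrow> y \<in> S)"

definition sgn_ell1 :: "'a ell1 \<Rightarrow> 'a ell1"
  where "sgn_ell1 f = inverse (norm f) *\<^sub>R f"

instance
proof
  fix f g h :: "'a ell1" and r s :: real and c d :: complex
  show "f + g + h = f + (g + h)" by transfer (simp add: add.assoc)
  show "f + g = g + f" by transfer (simp add: add.commute)
  show "0 + f = f" by transfer simp
  show "- f + f = 0" by transfer simp
  show "f - g = f + - g" by transfer simp
  show "r *\<^sub>R (f + g) = r *\<^sub>R f + r *\<^sub>R g"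
    unfolding scaleR_ell1_def by transfer (simp add: algebra_simps)
  show "(r + s) *\<^sub>R f = r *\<^sub>R f + s *\<^sub>R f"
    unfolding scaleR_ell1_def by transfer (simp add: algebra_simps)
  show "r *\<^sub>R s *\<^sub>R f = (r * s) *\<^sub>R f"
    unfolding scaleR_ell1_def by transfer (simp add: mult.assoc)
  show "1 *\<^sub>R f = f" unfolding scaleR_ell1_def by transfer simp
  show "dist f g = norm (f - g)" by (rule dist_ell1_def)
  show "sgn f = inverse (norm f) *\<^sub>R f" by (rule sgn_ell1_def)
  show "uniformity = (INF e\<in>{0 <..}. principal {(x :: 'a ell1, y). dist x y < e})"
    by (rule uniformity_ell1_def)
  show "open U = (\<forall>x\<in>U. \<forall>\<^sub>F (x', y) in uniformity. x' = x \<longrightarrow> y \<in> U)"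
    for U :: "'a ell1 set" by (rule open_ell1_def)
  show "norm f = 0 \<longleftrightarrow> f = 0"
  proof transfer
    fix f :: "'a \<Rightarrow> complex"
    assume f: "f abs_summable_on UNIV"
    show "(\<Sum>\<^sub>\<infinity>s. cmod (f s)) = 0 \<longleftrightarrow> f = (\<lambda>_. 0)"
      using nonneg_infsum_le_0D[of "\<lambda>s. cmod (f s)" UNIV] f by fastforce
  qed
  show "norm (f + g) \<le> norm f + norm g"
  proof transfer
    fix f g :: "'a \<Rightarrow> complex"
    assume fg: "f abs_summable_on UNIV" "g abs_summable_on UNIV"
    have "(\<Sum>\<^sub>\<infinity>s. cmod (f s + g s)) \<le> (\<Sum>\<^sub>\<infinity>s. cmod (f s) + cmod (g s))"
      using fg by (intro infsum_mono abs_summable_add summable_on_add norm_triangle_ineq)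
    also have "\<dots> = (\<Sum>\<^sub>\<infinity>s. cmod (f s)) + (\<Sum>\<^sub>\<infinity>s. cmod (g s))"
      using fg by (rule infsum_add)
    finally show "(\<Sum>\<^sub>\<infinity>s. cmod (f s + g s)) \<le> (\<Sum>\<^sub>\<infinity>s. cmod (f s)) + (\<Sum>\<^sub>\<infinity>s. cmod (g s))" .
  qed
  show nc: "norm (c *\<^sub>C f) = cmod c * norm f" for c and f :: "'a ell1"
    by transfer (simp add: norm_mult infsum_cmult_right)
  show "norm (r *\<^sub>R f) = \<bar>r\<bar> * norm f" by (simp add: scaleR_ell1_def nc)
  show "c *\<^sub>C (f + g) = c *\<^sub>C f + c *\<^sub>C g" by transfer (simp add: algebra_simps)
  show "(c + d) *\<^sub>C f = c *\<^sub>C f + d *\<^sub>C f" by transfer (simp add: algebra_simps)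
  show "c *\<^sub>C d *\<^sub>C f = (c * d) *\<^sub>C f" by transfer (simp add: mult.assoc)
  show "complex_of_real r *\<^sub>C f = r *\<^sub>R f" by (simp add: scaleR_ell1_def)
qed

end

lemma norm_ell1_apply: "cmod (ell1_apply f s) \<le> norm f"
proof transfer
  fix f :: "'a \<Rightarrow> complex" and s
  assume "f abs_summable_on UNIV"
  then show "cmod (f s) \<le> (\<Sum>\<^sub>\<infinity>s. cmod (f s))"
    using finite_sum_le_infsum[of "\<lambda>s. cmod (f s)" UNIV "{s}"] by simp
qed

lemma sum_ell1_le_norm: "finite F \<Longrightarrow> (\<Sum>s\<in>F. cmod (ell1_apply f s)) \<le> norm f"
  by transfer (auto intro: finite_sum_le_infsum)

lemma ell1_apply_minus: "ell1_apply (f - g) s = ell1_apply f s - ell1_apply g s"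
  by transfer simp

instance ell1 :: (type) complex_banach
proof
  fix X :: "nat \<Rightarrow> 'a ell1"
  assume X: "Cauchy X"
  have "Cauchy (\<lambda>n. ell1_apply (X n) s)" for s
    using X unfolding Cauchy_def dist_norm
    by (metis ell1_apply_minus norm_ell1_apply order_le_less_trans)
  then have "\<forall>s. \<exists>y. (\<lambda>n. ell1_apply (X n) s) \<longlonglongrightarrow> y"
    by (simp add: Cauchy_convergent_iff convergent_def)
  then obtain f where f: "\<And>s. (\<lambda>n. ell1_apply (X n) s) \<longlonglongrightarrow> f s"
    by metis
  have fin: "\<exists>M. \<forall>n\<ge>M. \<forall>F. finite F \<longrightarrow> (\<Sum>s\<in>F. cmod (ell1_apply (X n) s - f s)) \<le> \<epsilon>"
    if eps: "\<epsilon> > 0" for \<epsilon>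
  proof -
    obtain M where M: "\<And>m n. m \<ge> M \<Longrightarrow> n \<ge> M \<Longrightarrow> norm (X m - X n) < \<epsilon>"
      using CauchyD[OF X eps] by blast
    have "(\<Sum>s\<in>F. cmod (ell1_apply (X n) s - f s)) \<le> \<epsilon>" if n: "n \<ge> M" and "finite F" for n F
    proof (rule tendsto_upperbound)
      show "(\<lambda>m. \<Sum>s\<in>F. cmod (ell1_apply (X n) s - ell1_apply (X m) s))
          \<longlonglongrightarrow> (\<Sum>s\<in>F. cmod (ell1_apply (X n) s - f s))"
        by (intro tendsto_intros f)
      have "(\<Sum>s\<in>F. cmod (ell1_apply (X n) s - ell1_apply (X m) s)) \<le> \<epsilon>" if "m \<ge> M" for m
        using sum_ell1_le_norm[OF \<open>finite F\<close>, of "X n - X m"] M[OF n that]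
        by (simp add: ell1_apply_minus)
      then show "\<forall>\<^sub>F m in sequentially.
          (\<Sum>s\<in>F. cmod (ell1_apply (X n) s - ell1_apply (X m) s)) \<le> \<epsilon>"
        using eventually_sequentially by blast
    qed simp
    then show ?thesis by blast
  qed
  have diff: "(\<lambda>s. ell1_apply (X n) s - f s) abs_summable_on UNIV"
    if "\<forall>F. finite F \<longrightarrow> (\<Sum>s\<in>F. cmod (ell1_apply (X n) s - f s)) \<le> \<epsilon>" for n \<epsilon>
    unfolding abs_summable_iff_bdd_above using that by (intro bdd_aboveI[of _ \<epsilon>]) auto
  obtain n0 where "\<forall>F. finite F \<longrightarrow> (\<Sum>s\<in>F. cmod (ell1_apply (X n0) s - f s)) \<le> 1"
    using fin[of 1] by auto
  from diff[OF this] have d: "(\<lambda>s. - (ell1_apply (X n0) s - f s)) abs_summable_on UNIV"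
    by (simp add: norm_minus_commute)
  have "(\<lambda>s. ell1_apply (X n0) s + - (ell1_apply (X n0) s - f s)) abs_summable_on UNIV"
    by (rule abs_summable_add[OF ell1_abs_summable d])
  then have fs: "f abs_summable_on UNIV" by simp
  define g where "g = Abs_ell1 f"
  have g: "ell1_apply g = f"
    unfolding g_def by (rule Abs_ell1_inverse) (simp add: fs)
  have "X \<longlonglongrightarrow> g"
  proof (rule LIMSEQ_I)
    fix \<epsilon> :: real assume "\<epsilon> > 0"
    then obtain M where M: "\<And>n F. n \<ge> M \<Longrightarrow> finite F \<Longrightarrow>
        (\<Sum>s\<in>F. cmod (ell1_apply (X n) s - f s)) \<le> \<epsilon> / 2"
      using fin[of "\<epsilon> / 2"] by auto
    have "norm (X n - g) \<le> \<epsilon> / 2" if "n \<ge> M" for n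
    proof -
      have "norm (X n - g) = (\<Sum>\<^sub>\<infinity>s. cmod (ell1_apply (X n) s - f s))"
        by (simp add: norm_ell1.rep_eq ell1_apply_minus g)
      also have "\<dots> \<le> \<epsilon> / 2"
        using M[OF that] by (intro infsum_le_finite_sums diff[of _ "\<epsilon> / 2"]) auto
      finally show ?thesis .
    qed
    then show "\<exists>M. \<forall>n\<ge>M. norm (X n - g) < \<epsilon>"
      using \<open>\<epsilon> > 0\<close> by (metis field_sum_of_halves less_add_same_cancel1 half_gt_zero order_le_less_trans)
  qed
  then show "convergent X" by (auto simp: convergent_def)
qed

lemma abs_summable_times:
  fixes f :: "'s \<Rightarrow> complex" and g :: "'t \<Rightarrow> complex"
  assumes f: "f abs_summable_on UNIV" and g: "g abs_summable_on UNIV"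
  shows "(\<lambda>(s, t). f s * g t) abs_summable_on UNIV"
proof -
  have "(\<lambda>(s, t). f s * g t) abs_summable_on (UNIV \<times> UNIV)"
    unfolding Infinite_Sum.abs_summable_on_Sigma_iff
    using f g by (auto simp: norm_mult infsum_cmult_right abs_mult
        intro!: summable_on_cmult_right summable_on_cmult_left)
  then show ?thesis by simp
qed

lemma fibre_bij:
  "bij_betw snd (SIGMA x:UNIV. {(s, t). s * t = (x :: 's::semigroup_mult)}) UNIV"
  by (rule bij_betwI[of _ _ _ "\<lambda>(s, t). (s * t, (s, t))"]) auto

lemma fibre_summable:
  fixes F :: "'s::semigroup_mult \<times> 's \<Rightarrow> complex"
  assumes "F abs_summable_on UNIV"
  shows "F summable_on {(s, t). s * t = x}"
    and "(\<lambda>x. \<Sum>\<^sub>\<infinity>p\<in>{(s, t). s * t = x}. F p) abs_summable_on UNIV"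
    and "(\<Sum>\<^sub>\<infinity>x. \<Sum>\<^sub>\<infinity>p\<in>{(s, t). s * t = x}. F p) = (\<Sum>\<^sub>\<infinity>p. F p)"
    and "(\<Sum>\<^sub>\<infinity>x. cmod (\<Sum>\<^sub>\<infinity>p\<in>{(s, t). s * t = x}. F p)) \<le> (\<Sum>\<^sub>\<infinity>p. cmod (F p))"
proof -
  let ?A = "\<lambda>x. {(s, t). s * t = (x::'s)}"
  have sub: "F abs_summable_on ?A x" for x
    using assms summable_on_subset_banach by blast
  show "F summable_on {(s, t). s * t = x}"
    by (rule abs_summable_summable[OF sub])
  have sig: "(\<lambda>p. F (snd p)) abs_summable_on Sigma UNIV ?A"
    using summable_on_reindex_bij_betw[OF fibre_bij, of "\<lambda>p. cmod (F p)"] assms by simp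
  then have sig': "(\<lambda>(x, p). F p) abs_summable_on Sigma UNIV ?A"
    by (simp add: case_prod_unfold)
  have nn: "(\<lambda>x. \<Sum>\<^sub>\<infinity>p\<in>?A x. cmod (F p)) summable_on UNIV"
    using sig' unfolding Infinite_Sum.abs_summable_on_Sigma_iff
    using summable_on_iff_abs_summable_on_real by fastforce
  have le: "cmod (\<Sum>\<^sub>\<infinity>p\<in>?A x. F p) \<le> (\<Sum>\<^sub>\<infinity>p\<in>?A x. cmod (F p))" for x
    by (rule norm_infsum_bound[OF sub])
  show s2: "(\<lambda>x. \<Sum>\<^sub>\<infinity>p\<in>?A x. F p) abs_summable_on UNIV"
    by (rule Infinite_Sum.abs_summable_on_comparison_test'[OF nn]) (rule le)
  have "(\<Sum>\<^sub>\<infinity>x. \<Sum>\<^sub>\<infinity>p\<in>?A x. F p) = (\<Sum>\<^sub>\<infinity>(x, p)\<in>Sigma UNIV ?A. F p)"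
    by (rule infsum_Sigma'_banach[OF abs_summable_summable[OF sig']])
  also have "\<dots> = (\<Sum>\<^sub>\<infinity>p. F p)"
    using infsum_reindex_bij_betw[OF fibre_bij, of F] by (simp add: case_prod_unfold)
  finally show "(\<Sum>\<^sub>\<infinity>x. \<Sum>\<^sub>\<infinity>p\<in>?A x. F p) = (\<Sum>\<^sub>\<infinity>p. F p)" .
  have "(\<Sum>\<^sub>\<infinity>x. cmod (\<Sum>\<^sub>\<infinity>p\<in>?A x. F p)) \<le> (\<Sum>\<^sub>\<infinity>x. \<Sum>\<^sub>\<infinity>p\<in>?A x. cmod (F p))"
    by (rule infsum_mono[OF s2 nn le])
  also have "\<dots> = (\<Sum>\<^sub>\<infinity>(x, p)\<in>Sigma UNIV ?A. cmod (F p))"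
    using sig' by (intro infsum_Sigma'_banach) (simp add: case_prod_unfold)
  also have "\<dots> = (\<Sum>\<^sub>\<infinity>p. cmod (F p))"
    using infsum_reindex_bij_betw[OF fibre_bij, of "\<lambda>p. cmod (F p)"] by (simp add: case_prod_unfold)
  finally show "(\<Sum>\<^sub>\<infinity>x. cmod (\<Sum>\<^sub>\<infinity>p\<in>?A x. F p)) \<le> (\<Sum>\<^sub>\<infinity>p. cmod (F p))" .
qed

instantiation ell1 :: (semigroup_mult) times
begin

lift_definition times_ell1 :: "'a ell1 \<Rightarrow> 'a ell1 \<Rightarrow> 'a ell1"
  is "\<lambda>f g x. \<Sum>\<^sub>\<infinity>(s, t)\<in>{(s, t). s * t = x}. f s * g t"
  by (rule fibre_summable(2)[OF abs_summable_times])

instance ..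

end

lemma ell1_pairing_times:
  fixes f g :: "'s::semigroup_mult ell1" and \<phi> :: "'s \<Rightarrow> complex"
  assumes \<phi>: "\<And>s. cmod (\<phi> s) \<le> K"
  shows "(\<Sum>\<^sub>\<infinity>x. ell1_apply (f * g) x * \<phi> x)
    = (\<Sum>\<^sub>\<infinity>s. ell1_apply f s * (\<Sum>\<^sub>\<infinity>t. ell1_apply g t * \<phi> (s * t)))"
proof -
  let ?F = "\<lambda>(s, t). ell1_apply f s * ell1_apply g t"
  let ?G = "\<lambda>(s, t). ell1_apply f s * ell1_apply g t * \<phi> (s * t)"
  have F: "?F abs_summable_on UNIV"
    by (rule abs_summable_times[OF ell1_abs_summable ell1_abs_summable])
  have G: "?G abs_summable_on UNIV"
  proof (rule Infinite_Sum.abs_summable_on_comparison_test')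
    show "(\<lambda>p. cmod (?F p) * K) summable_on UNIV"
      by (rule summable_on_cmult_left[OF F])
    show "cmod (?G p) \<le> cmod (?F p) * K" for p
      using \<phi> by (auto simp: norm_mult mult_left_mono split: prod.splits)
  qed
  have "ell1_apply (f * g) x * \<phi> x = (\<Sum>\<^sub>\<infinity>p\<in>{(s, t). s * t = x}. ?G p)" for x
  proof -
    have "ell1_apply (f * g) x * \<phi> x = (\<Sum>\<^sub>\<infinity>p\<in>{(s, t). s * t = x}. ?F p * \<phi> x)"
      unfolding times_ell1.rep_eq
      by (rule infsum_cmult_left[symmetric]) (rule fibre_summable(1)[OF F])
    also have "\<dots> = (\<Sum>\<^sub>\<infinity>p\<in>{(s, t). s * t = x}. ?G p)"
      by (rule infsum_cong) auto
    finally show ?thesis .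
  qed
  then have "(\<Sum>\<^sub>\<infinity>x. ell1_apply (f * g) x * \<phi> x) = (\<Sum>\<^sub>\<infinity>p. ?G p)"
    using fibre_summable(3)[OF G] by simp
  also have "\<dots> = (\<Sum>\<^sub>\<infinity>s. \<Sum>\<^sub>\<infinity>t. ell1_apply f s * ell1_apply g t * \<phi> (s * t))"
    using infsum_Sigma'_banach[of "\<lambda>s t. ell1_apply f s * ell1_apply g t * \<phi> (s * t)"
        UNIV "\<lambda>_. UNIV"] abs_summable_summable[OF G] by simp
  also have "\<dots> = (\<Sum>\<^sub>\<infinity>s. ell1_apply f s * (\<Sum>\<^sub>\<infinity>t. ell1_apply g t * \<phi> (s * t)))"
    by (simp add: mult.assoc infsum_cmult_right')
  finally show ?thesis .
qed

lemma ell1_summable_pairing: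
  assumes "\<And>s. cmod (\<phi> s) \<le> K"
  shows "(\<lambda>s. ell1_apply f s * \<phi> s) abs_summable_on UNIV"
    and "cmod (\<Sum>\<^sub>\<infinity>s. ell1_apply f s * \<phi> s) \<le> norm f * K"
proof -
  have le: "cmod (ell1_apply f s * \<phi> s) \<le> cmod (ell1_apply f s) * K" for s
    using assms by (simp add: norm_mult mult_left_mono)
  have K: "(\<lambda>s. cmod (ell1_apply f s) * K) summable_on UNIV"
    by (rule summable_on_cmult_left[OF ell1_abs_summable])
  show *: "(\<lambda>s. ell1_apply f s * \<phi> s) abs_summable_on UNIV"
    by (rule Infinite_Sum.abs_summable_on_comparison_test'[OF K le])
  have "cmod (\<Sum>\<^sub>\<infinity>s. ell1_apply f s * \<phi> s) \<le> (\<Sum>\<^sub>\<infinity>s. cmod (ell1_apply f s * \<phi> s))"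
    by (rule norm_infsum_bound[OF *])
  also have "\<dots> \<le> (\<Sum>\<^sub>\<infinity>s. cmod (ell1_apply f s) * K)"
    by (rule infsum_mono[OF * K le])
  also have "\<dots> = norm f * K"
    by (simp add: norm_ell1.rep_eq infsum_cmult_left')
  finally show "cmod (\<Sum>\<^sub>\<infinity>s. ell1_apply f s * \<phi> s) \<le> norm f * K" .
qed

lemma ell1_apply_eq_pairing:
  "ell1_apply f x = (\<Sum>\<^sub>\<infinity>s. ell1_apply f s * (if s = x then 1 else 0))"
proof -
  have "(\<Sum>\<^sub>\<infinity>s. ell1_apply f s * (if s = x then 1 else 0))
      = (\<Sum>\<^sub>\<infinity>s\<in>{x}. ell1_apply f s * (if s = x then 1 else 0))"
    by (rule infsum_cong_neutral) auto
  then show ?thesis by simp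
qed

instance ell1 :: (semigroup_mult) complex_banach_algebra
proof
  fix f g h :: "'a ell1" and c :: complex and r :: real
  note F = abs_summable_times[OF ell1_abs_summable ell1_abs_summable]
  have ap: "ell1_apply (f * g) x = (\<Sum>\<^sub>\<infinity>p\<in>{(s, t). s * t = x}.
      case p of (s, t) \<Rightarrow> ell1_apply f s * ell1_apply g t)" for f g :: "'a ell1" and x
    by (rule times_ell1.rep_eq[THEN fun_cong])
  have plus: "ell1_apply (f + g) x = ell1_apply f x + ell1_apply g x"
    and scale: "ell1_apply (c *\<^sub>C f) x = c * ell1_apply f x" for f g :: "'a ell1" and x c
    by (transfer, simp)+
  show "f * g * h = f * (g * h)"
  proof (rule ell1_eqI)
    fix x
    let ?d = "\<lambda>s :: 'a. if s = x then 1 else 0 :: complex"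
    have d: "cmod (?d s) \<le> 1" for s by simp
    have d2: "cmod (\<Sum>\<^sub>\<infinity>t. ell1_apply h t * ?d (s * t)) \<le> norm h * 1" for s
      by (rule ell1_summable_pairing(2)) simp
    have tp: "ell1_apply (f * g) x
        = (\<Sum>\<^sub>\<infinity>s. ell1_apply f s * (\<Sum>\<^sub>\<infinity>t. ell1_apply g t * ?d (s * t)))" for f g
      by (rule trans[OF ell1_apply_eq_pairing ell1_pairing_times[of ?d 1, OF d]])
    have gh: "(\<Sum>\<^sub>\<infinity>v. ell1_apply (g * h) v * ?d (s * v)) = (\<Sum>\<^sub>\<infinity>t. ell1_apply g t *
        (\<Sum>\<^sub>\<infinity>u. ell1_apply h u * ?d (s * (t * u))))" for s
      by (rule ell1_pairing_times[of "\<lambda>v. ?d (s * v)" 1]) simp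
    have "ell1_apply (f * g * h) x = (\<Sum>\<^sub>\<infinity>s. ell1_apply f s *
        (\<Sum>\<^sub>\<infinity>t. ell1_apply g t * (\<Sum>\<^sub>\<infinity>u. ell1_apply h u * ?d (s * t * u))))"
      by (rule trans[OF tp ell1_pairing_times[OF d2]])
    also have "\<dots> = (\<Sum>\<^sub>\<infinity>s. ell1_apply f s * (\<Sum>\<^sub>\<infinity>v. ell1_apply (g * h) v * ?d (s * v)))"
      unfolding gh mult.assoc ..
    also have "\<dots> = ell1_apply (f * (g * h)) x"
      by (rule tp[symmetric])
    finally show "ell1_apply (f * g * h) x = ell1_apply (f * (g * h)) x" .
  qed
  show "(f + g) * h = f * h + g * h"
  proof (rule ell1_eqI)
    show "ell1_apply ((f + g) * h) x = ell1_apply (f * h + g * h) x" for x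
      unfolding plus ap
      by (subst infsum_add[symmetric, OF fibre_summable(1)[OF F] fibre_summable(1)[OF F]])
        (auto intro!: infsum_cong simp: plus algebra_simps)
  qed
  show "f * (g + h) = f * g + f * h"
  proof (rule ell1_eqI)
    show "ell1_apply (f * (g + h)) x = ell1_apply (f * g + f * h) x" for x
      unfolding plus ap
      by (subst infsum_add[symmetric, OF fibre_summable(1)[OF F] fibre_summable(1)[OF F]])
        (auto intro!: infsum_cong simp: plus algebra_simps)
  qed
  show 1: "(c *\<^sub>C f) * g = c *\<^sub>C (f * g)" for c
  proof (rule ell1_eqI)
    show "ell1_apply ((c *\<^sub>C f) * g) x = ell1_apply (c *\<^sub>C (f * g)) x" for x
      unfolding scale ap
      by (subst infsum_cmult_right'[symmetric]) (auto intro!: infsum_cong simp: scale mult.assoc)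
  qed
  show 2: "f * (c *\<^sub>C g) = c *\<^sub>C (f * g)" for c
  proof (rule ell1_eqI)
    show "ell1_apply (f * (c *\<^sub>C g)) x = ell1_apply (c *\<^sub>C (f * g)) x" for x
      unfolding scale ap
      by (subst infsum_cmult_right'[symmetric]) (auto intro!: infsum_cong simp: scale mult_ac)
  qed
  show "r *\<^sub>R f * g = r *\<^sub>R (f * g)" "f * r *\<^sub>R g = r *\<^sub>R (f * g)"
    by (simp_all add: scaleR_ell1_def 1 2)
  show "norm (f * g) \<le> norm f * norm g"
  proof -
    have "norm (f * g) \<le> (\<Sum>\<^sub>\<infinity>p. cmod (case p of (s, t) \<Rightarrow> ell1_apply f s * ell1_apply g t))"
      unfolding norm_ell1.rep_eq ap by (rule fibre_summable(4)[OF F])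
    also have "\<dots> = (\<Sum>\<^sub>\<infinity>s. \<Sum>\<^sub>\<infinity>t. cmod (ell1_apply f s * ell1_apply g t))"
      using infsum_Sigma'_banach[of "\<lambda>s t. cmod (ell1_apply f s * ell1_apply g t)"
          UNIV "\<lambda>_. UNIV"] F[of f g] by (simp add: case_prod_unfold)
    also have "\<dots> = norm f * norm g"
      by (simp add: norm_mult infsum_cmult_right' infsum_cmult_left' norm_ell1.rep_eq)
    finally show ?thesis .
  qed
qed

lift_definition ell1_delta :: "'s \<Rightarrow> 's ell1" is "\<lambda>s t. if t = s then 1 else 0"
proof -
  fix s :: 's
  have "(\<lambda>t. cmod (if t = s then 1 else 0)) summable_on {s}" by simp
  then show "(\<lambda>t. cmod (if t = s then 1 else 0)) summable_on UNIV"
    by (rule summable_on_cong_neutral[THEN iffD1, rotated -1]) auto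
qed

lemma ell1_delta_times: "ell1_delta s * ell1_delta t = ell1_delta (s * t :: 's::semigroup_mult)"
proof (rule ell1_eqI)
  fix x
  have "(\<Sum>\<^sub>\<infinity>(u, v)\<in>{(u, v). u * v = x}. (if u = s then 1 else 0) * (if v = t then 1 else 0))
    = (\<Sum>\<^sub>\<infinity>p\<in>{(s, t)} \<inter> {(u, v). u * v = x}. 1 :: complex)"
    by (rule infsum_cong_neutral) (auto split: if_splits)
  also have "\<dots> = (if x = s * t then 1 else 0)" by auto
  finally show "ell1_apply (ell1_delta s * ell1_delta t) x = ell1_apply (ell1_delta (s * t)) x"
    by (simp add: times_ell1.rep_eq ell1_delta.rep_eq)
qed

end

theory Submission
  imports Defs
begin

text \<open>
  Write \<open>A\<close> for the semigroup algebra. Both directions use that an element \<open>x\<close> links the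
  idempotents \<open>x x\<^sup>*\<close> and \<open>x\<^sup>* x\<close>, and that any two idempotents in one class are linked in
  this way.

  Suppose \<open>m\<close> in the bidual commutes with \<open>A\<close>. For an idempotent \<open>e\<close> let \<open>\<phi>\<^sub>e\<close> be the functional on
  \<open>A\<close> that is the indicator of the up-set \<open>{t. t \<ge> e}\<close> for the natural partial order. Testing
  \<open>\<delta>\<^sub>x \<cdot> m = m \<cdot> \<delta>\<^sub>x\<close> on the indicator of the up-set of \<open>x\<close> shows that \<open>m\<close> takes the same value
  at \<open>\<phi>\<^sub>e\<close> for all idempotents \<open>e\<close> of a class, as a trace does on equivalent projections. A sum of
  \<open>\<phi>\<^sub>e\<close> over any finite set of idempotents has norm at most the bound \<open>N\<close> on the number of
  idempotents below a given one, so if the class has infinitely many idempotents, then \<open>m \<phi>\<^sub>e = 0\<close>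
  (\<open>norm_sum_up_set_functional_le\<close>). But then \<open>m \<cdot> \<delta>\<^sub>e\<close> and \<open>\<delta>\<^sub>e\<close> differ by \<open>1\<close> at \<open>\<phi>\<^sub>e\<close>, which has norm at
  most \<open>1\<close>, so \<open>m\<close> cannot belong to the late part of an approximate identity.

  Conversely, a finite commutative semigroup \<open>G\<close> of idempotents has a unit in the linear span of its
  point masses, of norm at most \<open>2 ^ card G\<close> (\<open>finite_semilattice_unit\<close>). If \<open>J\<close> is a two-sided
  ideal of \<open>S\<close> with finitely many idempotents, the unit \<open>u\<^sub>J\<close> of its idempotents is a unit for all of
  \<open>J\<close>, and a unit of an ideal is central. Multiplication by \<open>u\<^sub>J\<close> has norm at most \<open>2 ^ N\<close> whatever \<open>J\<close>
  is, because on \<open>\<delta>\<^sub>s\<close> it acts as the unit of the at most \<open>N\<close> idempotents of \<open>J\<close> below \<open>s s\<^sup>*\<close>. When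
  the classes have finitely many idempotents, every element of \<open>S\<close> lies in such an ideal
  (\<open>principal_ideal_idempotents_finite\<close>), so the \<open>u\<^sub>J\<close>, directed by inclusion of ideals, fix each
  finitely supported element eventually and hence, by the uniform bound, converge to the identity on
  all of \<open>A\<close>.
\<close>

section \<open>Inverse semigroups\<close>

lemma star_eqI:
  fixes s :: "'s::inverse_semigroup"
  assumes "s * t * s = s" "t * s * t = t"
  shows "star s = t"
  using ex1_generalized_inverse[of s] star_laws[of s] assms by metis

lemma star_star [simp]: "star (star s) = (s :: 's::inverse_semigroup)"
  by (rule star_eqI) (simp_all add: star_laws)

lemma star_idempotent: "e \<in> idempotents \<Longrightarrow> star e = (e :: 's::inverse_semigroup)"
  by (rule star_eqI) (simp_all add: idempotents_def)

lemma range_projection_idempotent [simp]: "s * star s \<in> (idempotents :: 's::inverse_semigroup set)"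
  and source_projection_idempotent [simp]: "star s * s \<in> (idempotents :: 's::inverse_semigroup set)"
  by (simp_all add: idempotents_def mult.assoc[symmetric] star_laws)

text \<open>If \<open>x\<close> is the inverse of \<open>e f\<close>, then so is \<open>f x e\<close>; uniqueness gives \<open>x = f x e\<close>, which makes \<open>x\<close>
  idempotent. An idempotent is its own inverse, so \<open>e f\<close>, the inverse of \<open>x\<close>, is \<open>x\<close> itself.\<close>

lemma idempotents_mult_closed:
  fixes e f :: "'s::inverse_semigroup"
  assumes e: "e \<in> idempotents" and f: "f \<in> idempotents"
  shows "e * f \<in> idempotents"
proof -
  have ee: "e * e = e" "e * (e * z) = e * z" and ff: "f * f = f" "f * (f * z) = f * z" for z
    using e f by (simp_all add: idempotents_def mult.assoc[symmetric])
  define x where "x = star (e * f)"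
  have efx: "e * (f * (x * (e * f))) = e * f" and xef: "x * (e * (f * x)) = x"
    using star_laws[of "e * f"] by (simp_all add: x_def mult.assoc)
  have xefz: "x * (e * (f * (x * z))) = x * z" for z
    using arg_cong[OF xef, of "\<lambda>y. y * z"] by (simp add: mult.assoc)
  have "star (e * f) = f * x * e"
    by (rule star_eqI) (simp_all add: mult.assoc ee ff efx xefz)
  then have x: "x = f * x * e" by (simp add: x_def)
  have "x * x = (f * x * e) * (f * x * e)" by (simp add: x[symmetric])
  also have "\<dots> = f * x * e" by (simp add: mult.assoc xefz)
  finally have "x \<in> idempotents" by (simp add: idempotents_def x[symmetric])
  moreover have "e * f = star x" by (simp add: x_def)
  ultimately show ?thesis by (simp add: star_idempotent)
qed

text \<open>Since products of idempotents are idempotent, \<open>f e\<close> is an inverse of \<open>e f\<close>, but \<open>e f\<close> is its own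
  inverse as well.\<close>

lemma idempotents_commute:
  fixes e f :: "'s::inverse_semigroup"
  assumes "e \<in> idempotents" "f \<in> idempotents"
  shows "e * f = f * e"
proof -
  have ee: "e * e = e" "e * (e * z) = e * z" and ff: "f * f = f" "f * (f * z) = f * z" for z
    using assms by (simp_all add: idempotents_def mult.assoc[symmetric])
  have ef: "e * (f * (e * f)) = e * f" "f * (e * (f * e)) = f * e"
    using idempotents_mult_closed[OF assms] idempotents_mult_closed[OF assms(2,1)]
    by (simp_all add: idempotents_def mult.assoc)
  have "star (e * f) = f * e"
    by (rule star_eqI) (simp_all add: mult.assoc ee ff ef)
  then show ?thesis
    using star_idempotent[OF idempotents_mult_closed[OF assms]] by simp
qed

lemma star_mult: "star (s * t) = star t * star (s :: 's::inverse_semigroup)"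
proof (rule star_eqI)
  have c: "t * star t * (star s * s) = star s * s * (t * star t)"
    by (rule idempotents_commute) simp_all
  have "s * t * (star t * star s) * (s * t) = s * (t * star t * (star s * s)) * t"
    by (simp add: mult.assoc)
  also have "\<dots> = (s * star s * s) * (t * star t * t)"
    unfolding c by (simp add: mult.assoc)
  finally show "s * t * (star t * star s) * (s * t) = s * t"
    by (simp add: star_laws)
  have "star t * star s * (s * t) * (star t * star s) = star t * (star s * s * (t * star t)) * star s"
    by (simp add: mult.assoc)
  also have "\<dots> = (star t * t * star t) * (star s * s * star s)"
    unfolding c[symmetric] by (simp add: mult.assoc)
  finally show "star t * star s * (s * t) * (star t * star s) = star t * star s"
    by (simp add: star_laws)
qed

text \<open>Both sides say that \<open>e\<close> lies below \<open>t\<close> in the natural partial order of \<open>S\<close>.\<close>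

lemma idempotent_absorbs_right_iff_left:
  fixes e t :: "'s::inverse_semigroup"
  assumes e: "e \<in> idempotents"
  shows "t * e = e \<longleftrightarrow> e * t = e"
proof -
  have *: "e * t = e" if te: "t * e = e" for t
  proof -
    have s: "e * star t = e"
      using arg_cong[OF te, of star] by (simp add: star_mult star_idempotent[OF e])
    have "e = e * star t * (t * e)" using s te e by (simp add: idempotents_def)
    also have "\<dots> = e * (star t * t * e)" by (simp add: mult.assoc)
    also have "\<dots> = e * (e * (star t * t))"
      using idempotents_commute[OF e, of "star t * t"] by simp
    also have "\<dots> = e * star t * t"
      using e by (simp add: idempotents_def mult.assoc[symmetric])
    also have "\<dots> = e * t" by (simp add: s)
    finally show ?thesis by simp
  qed
  have "t * e = e" if et: "e * t = e"
  proof -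
    have "star t * e = e"
      using arg_cong[OF et, of star] by (simp add: star_mult star_idempotent[OF e])
    from arg_cong[OF *[OF this], of star] show ?thesis
      by (simp add: star_mult star_idempotent[OF e])
  qed
  with * show ?thesis by blast
qed

text \<open>The number of idempotents below an arbitrary element \<open>t\<close> is thereby controlled by the number of
  idempotents below the idempotent \<open>t t\<^sup>*\<close>.\<close>

lemma idem_le_range_projection:
  fixes f t :: "'s::inverse_semigroup"
  assumes f: "f \<in> idempotents" and ft: "f * t = f"
  shows "idem_le f (t * star t)"
proof -
  have "star t * f = f"
    using arg_cong[OF ft, of star] by (simp add: star_mult star_idempotent[OF f])
  moreover have "t * f = f" using idempotent_absorbs_right_iff_left[OF f] ft by simp
  ultimately have "t * star t * f = f" by (simp add: mult.assoc)
  then show ?thesis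
    using idempotents_commute[OF f, of "t * star t"] by (simp add: idem_le_def)
qed


section \<open>Functionals and operators on the semigroup algebra\<close>

lemma ell1_apply_plus: "ell1_apply (a + b) s = ell1_apply a s + ell1_apply b s"
  and ell1_apply_scaleC: "ell1_apply (c *\<^sub>C a) s = c * ell1_apply a s"
  and ell1_apply_zero: "ell1_apply 0 s = 0"
  by (transfer, simp)+

lemma ell1_apply_sum: "ell1_apply (\<Sum>i\<in>K. a i) s = (\<Sum>i\<in>K. ell1_apply (a i) s)"
  by (induction K rule: infinite_finite_induct) (simp_all add: ell1_apply_plus ell1_apply_zero)

lemma norm_ell1_delta [simp]: "norm (ell1_delta s) = 1"
proof -
  have "norm (ell1_delta s) = (\<Sum>\<^sub>\<infinity>t\<in>{s}. 1 :: real)"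
    unfolding norm_ell1.rep_eq ell1_delta.rep_eq by (rule infsum_cong_neutral) auto
  then show ?thesis by simp
qed

text \<open>The error of the partial sum over \<open>K\<close> has norm equal to the tail of the series of absolute values.
  This expansion determines a bounded operator or functional by its values on the point masses.\<close>

lemma ell1_delta_has_sum: "((\<lambda>s. ell1_apply a s *\<^sub>C ell1_delta s) has_sum a) UNIV"
proof -
  let ?S = "\<lambda>K. \<Sum>s\<in>K. ell1_apply a s *\<^sub>C ell1_delta s"
  have *: "dist (?S K) a = dist (\<Sum>s\<in>K. cmod (ell1_apply a s)) (norm a)" if K: "finite K" for K
  proof -
    have ap: "ell1_apply (a - ?S K) t = (if t \<in> K then 0 else ell1_apply a t)" for t
      using K by (simp add: ell1_apply_minus ell1_apply_sum ell1_apply_scaleC ell1_delta.rep_eq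
          if_distrib cong: if_cong)
    have "norm (a - ?S K) = (\<Sum>\<^sub>\<infinity>t\<in>UNIV - K. cmod (ell1_apply a t))"
      unfolding norm_ell1.rep_eq ap by (rule infsum_cong_neutral) auto
    also have "\<dots> = norm a - (\<Sum>s\<in>K. cmod (ell1_apply a s))"
      using K by (subst infsum_Diff) (simp_all add: ell1_abs_summable norm_ell1.rep_eq)
    finally show ?thesis
      using sum_ell1_le_norm[OF K, of a]
      by (simp add: dist_norm norm_minus_commute)
  qed
  have "((\<lambda>s. cmod (ell1_apply a s)) has_sum norm a) UNIV"
    unfolding norm_ell1.rep_eq by (rule has_sum_infsum[OF ell1_abs_summable])
  then have "((\<lambda>K. dist (\<Sum>s\<in>K. cmod (ell1_apply a s)) (norm a)) \<longlongrightarrow> 0) (finite_subsets_at_top UNIV)"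
    unfolding has_sum_def by (rule tendsto_dist_iff[THEN iffD1])
  then have "((\<lambda>K. dist (?S K) a) \<longlongrightarrow> 0) (finite_subsets_at_top UNIV)"
    by (rule Lim_transform_eventually)
      (auto intro!: eventually_finite_subsets_at_top_weakI simp: *)
  then show ?thesis
    unfolding has_sum_def by (rule tendsto_dist_iff[THEN iffD2])
qed

lemma ell1_operator_has_sum:
  fixes a :: "'s ell1" and T :: "'s ell1 \<Rightarrow> 'b::complex_normed_vector"
  assumes "bounded_linear T" "\<And>c x. T (c *\<^sub>C x) = c *\<^sub>C T x"
  shows "((\<lambda>s. ell1_apply a s *\<^sub>C T (ell1_delta s)) has_sum T a) UNIV"
  using has_sum_bounded_linear[OF assms(1) ell1_delta_has_sum] assms(2) by (simp add: o_def)

lemma ell1_operator_eqI: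
  fixes a :: "'s ell1" and T U :: "'s ell1 \<Rightarrow> 'b::complex_normed_vector"
  assumes "bounded_linear T" "\<And>c x. T (c *\<^sub>C x) = c *\<^sub>C T x"
    and "bounded_linear U" "\<And>c x. U (c *\<^sub>C x) = c *\<^sub>C U x"
    and "\<And>s. T (ell1_delta s) = U (ell1_delta s)"
  shows "T a = U a"
  using has_sum_unique[OF ell1_operator_has_sum[OF assms(1,2)]] ell1_operator_has_sum[OF assms(3,4)]
    assms(5) by simp

lemma ell1_operator_norm_le:
  fixes a :: "'s ell1" and T :: "'s ell1 \<Rightarrow> 'b::complex_normed_vector"
  assumes "bounded_linear T" "\<And>c x. T (c *\<^sub>C x) = c *\<^sub>C T x"
    and C: "\<And>s. norm (T (ell1_delta s)) \<le> C"
  shows "norm (T a) \<le> C * norm a"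
proof -
  have "((\<lambda>s. C * cmod (ell1_apply a s)) has_sum C * norm a) UNIV"
    unfolding norm_ell1.rep_eq
    by (rule has_sum_cmult_right[OF has_sum_infsum[OF ell1_abs_summable]])
  moreover have "norm (ell1_apply a s *\<^sub>C T (ell1_delta s)) \<le> C * cmod (ell1_apply a s)" for s
    using mult_left_mono[OF C, of "cmod (ell1_apply a s)" s]
    by (simp add: norm_scaleC mult.commute)
  ultimately show ?thesis
    by (rule norm_infsum_le[OF ell1_operator_has_sum[OF assms(1,2)]])
qed

lemma ell1_cdual_eqI:
  fixes f g :: "'s ell1 cdual"
  assumes "\<And>s. cdual_apply f (ell1_delta s) = cdual_apply g (ell1_delta s)"
  shows "f = g"
proof (rule cdual_eqI)
  fix a :: "'s ell1"
  have "((\<lambda>s. ell1_apply a s * cdual_apply h (ell1_delta s)) has_sum cdual_apply h a) UNIV"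
    for h :: "'s ell1 cdual"
    using has_sum_bounded_linear[OF bounded_linear_cdual_apply ell1_delta_has_sum, of h a]
    by (simp add: o_def cdual_apply_scaleC)
  from has_sum_unique[OF this[of f]] this[of g] show "cdual_apply f a = cdual_apply g a"
    by (simp add: assms)
qed

text \<open>The pairing defines an element of the dual only if \<open>\<phi>\<close> is bounded, which the lemmas below assume.\<close>

definition ell1_functional :: "('s \<Rightarrow> complex) \<Rightarrow> 's ell1 cdual"
  where "ell1_functional \<phi> = Abs_cdual (\<lambda>a. \<Sum>\<^sub>\<infinity>s. ell1_apply a s * \<phi> s)"

lemma ell1_functional_apply:
  fixes \<phi> :: "'s \<Rightarrow> complex"
  assumes K: "\<And>s. cmod (\<phi> s) \<le> K"
  shows "cdual_apply (ell1_functional \<phi>) a = (\<Sum>\<^sub>\<infinity>s. ell1_apply a s * \<phi> s)"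
proof -
  note sm = abs_summable_summable[OF ell1_summable_pairing(1)[of \<phi>, OF K]]
  have sc: "(\<Sum>\<^sub>\<infinity>s. ell1_apply (c *\<^sub>C a) s * \<phi> s) = c * (\<Sum>\<^sub>\<infinity>s. ell1_apply a s * \<phi> s)"
    for c and a :: "'s ell1"
    by (simp add: ell1_apply_scaleC mult.assoc infsum_cmult_right')
  have "bounded_linear (\<lambda>a. \<Sum>\<^sub>\<infinity>s. ell1_apply a s * \<phi> s)"
  proof (rule bounded_linear_intro)
    show "(\<Sum>\<^sub>\<infinity>s. ell1_apply (a + b) s * \<phi> s)
        = (\<Sum>\<^sub>\<infinity>s. ell1_apply a s * \<phi> s) + (\<Sum>\<^sub>\<infinity>s. ell1_apply b s * \<phi> s)" for a b
      unfolding ell1_apply_plus distrib_right by (rule infsum_add[OF sm sm])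
    show "(\<Sum>\<^sub>\<infinity>s. ell1_apply (r *\<^sub>R a) s * \<phi> s) = r *\<^sub>R (\<Sum>\<^sub>\<infinity>s. ell1_apply a s * \<phi> s)" for r a
      using sc[of "complex_of_real r" a] by (simp add: scaleR_ell1_def scaleR_conv_of_real)
    show "cmod (\<Sum>\<^sub>\<infinity>s. ell1_apply a s * \<phi> s) \<le> norm a * K" for a
      by (rule ell1_summable_pairing(2)[of \<phi>, OF K])
  qed
  with sc show ?thesis
    unfolding ell1_functional_def by (subst Abs_cdual_inverse) auto
qed

lemma ell1_functional_delta:
  assumes K: "\<And>s. cmod (\<phi> s) \<le> K"
  shows "cdual_apply (ell1_functional \<phi>) (ell1_delta s) = \<phi> s"
proof -
  have "(\<Sum>\<^sub>\<infinity>t. ell1_apply (ell1_delta s) t * \<phi> t) = (\<Sum>\<^sub>\<infinity>t\<in>{s}. \<phi> t)"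
    by (rule infsum_cong_neutral) (auto simp: ell1_delta.rep_eq)
  then show ?thesis by (simp add: ell1_functional_apply[of \<phi>, OF K])
qed

lemma norm_ell1_functional_le:
  assumes K: "\<And>s. cmod (\<phi> s) \<le> K"
  shows "norm (ell1_functional \<phi>) \<le> K"
proof (rule norm_cdual_bound)
  show "0 \<le> K" using norm_ge_zero[of "\<phi> undefined"] K[of undefined] by linarith
  show "cmod (cdual_apply (ell1_functional \<phi>) a) \<le> K * norm a" for a
    using ell1_summable_pairing(2)[of \<phi>, OF K, of a]
    by (simp add: ell1_functional_apply[of \<phi>, OF K] mult.commute)
qed

lemma cdual_apply_sum: "cdual_apply m (\<Sum>i\<in>X. f i) = (\<Sum>i\<in>X. cdual_apply m (f i))"
  using linear_sum[OF bounded_linear.linear[OF bounded_linear_cdual_apply]] by simp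

lemma cdual_apply_sum_left: "cdual_apply (\<Sum>i\<in>X. f i) a = (\<Sum>i\<in>X. cdual_apply (f i) a)"
proof -
  have "cdual_apply 0 a = 0" by transfer simp
  then show ?thesis
    by (induction X rule: infinite_finite_induct) (simp_all add: cdual_apply_plus)
qed


section \<open>The actions on the bidual\<close>

lemma bounded_cbilinear_times: "bounded_cbilinear ((*) :: 'a::complex_banach_algebra \<Rightarrow> 'a \<Rightarrow> 'a)"
  using banach_bimodule_times[where 'a = 'a] unfolding banach_bimodule_def by blast

lemmas dual_right_action_times_apply = apply_dual_right_action[OF bounded_cbilinear_times]
lemmas dual_left_action_times_apply = apply_dual_left_action[OF bounded_cbilinear_times]

lemma bidual_left_action_apply:
  "cdual_apply (bidual_left_action a m) \<psi> = cdual_apply m (dual_right_action (*) \<psi> a)"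
  unfolding bidual_left_action_def
  by (rule apply_dual_left_action[OF bounded_cbilinear_dual_right_action[OF bounded_cbilinear_times]])

lemma bidual_right_action_apply:
  "cdual_apply (bidual_right_action m a) \<psi> = cdual_apply m (dual_left_action (*) a \<psi>)"
  unfolding bidual_right_action_def
  by (rule apply_dual_right_action[OF bounded_cbilinear_dual_left_action[OF bounded_cbilinear_times]])

lemma bidual_left_action_canonical_embedding:
  "bidual_left_action a (canonical_embedding u) = canonical_embedding (a * u)"
  by (rule cdual_eqI)
    (simp add: bidual_left_action_apply canonical_embedding.rep_eq dual_right_action_times_apply)

lemma bidual_right_action_canonical_embedding:
  "bidual_right_action (canonical_embedding u) a = canonical_embedding (u * a)"
  by (rule cdual_eqI)
    (simp add: bidual_right_action_apply canonical_embedding.rep_eq dual_left_action_times_apply)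

lemma norm_canonical_embedding_diff_le:
  "norm (canonical_embedding x - canonical_embedding y) \<le> norm (x - y)"
proof (rule norm_cdual_bound)
  fix \<psi> :: "'a cdual"
  have "cdual_apply (canonical_embedding x - canonical_embedding y) \<psi> = cdual_apply \<psi> (x - y)"
    using linear_diff[OF bounded_linear.linear[OF bounded_linear_cdual_apply[of \<psi>]], of x y]
    by (simp add: minus_cdual.rep_eq canonical_embedding.rep_eq)
  then show "cmod (cdual_apply (canonical_embedding x - canonical_embedding y) \<psi>)
      \<le> norm (x - y) * norm \<psi>"
    using norm_cdual_apply[of \<psi> "x - y"] by (simp add: mult.commute)
qed simp


section \<open>Ultra central approximate identities force finite classes\<close>

text \<open>The identity \<open>x x\<^sup>* t = x\<close> says that \<open>x \<le> t\<close> in the natural partial order.\<close>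

definition up_set_functional :: "'s::inverse_semigroup \<Rightarrow> 's ell1 cdual"
  where "up_set_functional x = ell1_functional (\<lambda>t. of_bool (x * star x * t = x))"

lemma up_set_functional_delta:
  "cdual_apply (up_set_functional x) (ell1_delta t) = of_bool (x * star x * t = x)"
  unfolding up_set_functional_def by (rule ell1_functional_delta[where K = 1]) simp

lemma up_set_functional_idempotent_delta:
  assumes "e \<in> idempotents"
  shows "cdual_apply (up_set_functional e) (ell1_delta t) = of_bool (e * t = e)"
  using assms by (simp add: up_set_functional_delta star_idempotent idempotents_def)

text \<open>The condition \<open>x \<le> x t\<close> means \<open>x t = x\<close>, that is \<open>x\<^sup>* x \<le> t\<close>. Together with the mirror
  image below, this makes a central element of the bidual take equal values at the functionals of
  \<open>x\<^sup>* x\<close> and \<open>x x\<^sup>*\<close>.\<close>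

lemma up_set_functional_times_delta:
  fixes x :: "'s::inverse_semigroup"
  shows "dual_right_action (*) (up_set_functional x) (ell1_delta x) = up_set_functional (star x * x)"
proof (rule ell1_cdual_eqI)
  fix t
  have "x * star x * (x * t) = x \<longleftrightarrow> star x * x * t = star x * x"
  proof
    assume "x * star x * (x * t) = x"
    then have "x * t = x" by (simp add: mult.assoc[symmetric] star_laws)
    then show "star x * x * t = star x * x" by (simp add: mult.assoc)
  next
    assume "star x * x * t = star x * x"
    from arg_cong[OF this, of "\<lambda>y. x * y"] show "x * star x * (x * t) = x"
      by (simp add: mult.assoc[symmetric] star_laws)
  qed
  then show "cdual_apply (dual_right_action (*) (up_set_functional x) (ell1_delta x)) (ell1_delta t)
      = cdual_apply (up_set_functional (star x * x)) (ell1_delta t)"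
    by (simp add: dual_right_action_times_apply ell1_delta_times up_set_functional_delta[of x]
        up_set_functional_idempotent_delta)
qed

lemma delta_times_up_set_functional:
  fixes x :: "'s::inverse_semigroup"
  shows "dual_left_action (*) (ell1_delta x) (up_set_functional x) = up_set_functional (x * star x)"
proof (rule ell1_cdual_eqI)
  fix t
  let ?e = "x * star x"
  have ide: "?e * ?e = ?e" by (simp add: mult.assoc[symmetric] star_laws)
  have "?e * (t * x) = x \<longleftrightarrow> ?e * t = ?e"
  proof
    assume *: "?e * (t * x) = x"
    have "?e * t * ?e = ?e"
      using arg_cong[OF *, of "\<lambda>y. y * star x"] by (simp add: mult.assoc)
    then have "?e * (?e * t) = ?e"
      using idempotent_absorbs_right_iff_left[of ?e "?e * t"] by simp
    then show "?e * t = ?e" by (simp only: mult.assoc[of ?e ?e t, symmetric] ide)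
  next
    assume "?e * t = ?e"
    then show "?e * (t * x) = x" by (simp only: mult.assoc[of ?e t x, symmetric] star_laws)
  qed
  then show "cdual_apply (dual_left_action (*) (ell1_delta x) (up_set_functional x)) (ell1_delta t)
      = cdual_apply (up_set_functional (x * star x)) (ell1_delta t)"
    by (simp add: dual_left_action_times_apply ell1_delta_times up_set_functional_delta[of x]
        up_set_functional_idempotent_delta)
qed

text \<open>The sum, evaluated at the point mass of \<open>t\<close>, counts the members of \<open>X\<close> below \<open>t\<close>, and these lie
  below the idempotent \<open>t t\<^sup>*\<close>.\<close>

lemma norm_sum_up_set_functional_le:
  fixes X :: "'s::inverse_semigroup set"
  assumes X: "finite X" "X \<subseteq> idempotents"
    and N: "\<And>e :: 's. e \<in> idempotents \<Longrightarrow>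
      finite {f \<in> idempotents. idem_le f e} \<and> card {f \<in> idempotents. idem_le f e} \<le> N"
  shows "norm (\<Sum>f\<in>X. up_set_functional f) \<le> real N"
proof -
  define \<phi> where "\<phi> t = (\<Sum>f\<in>X. of_bool (f * t = f) :: complex)" for t
  have b: "cmod (\<phi> t) \<le> real N" for t
  proof -
    have "\<phi> t = of_nat (card {f \<in> X. f * t = f})"
      using X(1) by (simp add: \<phi>_def sum.If_cases of_bool_def Int_def)
    moreover have "{f \<in> X. f * t = f} \<subseteq> {f \<in> idempotents. idem_le f (t * star t)}"
      using X(2) idem_le_range_projection by blast
    then have "card {f \<in> X. f * t = f} \<le> N"
      using N[of "t * star t"] card_mono order_trans
      by (metis (no_types, lifting) range_projection_idempotent)
    ultimately show ?thesis by simp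
  qed
  have "(\<Sum>f\<in>X. up_set_functional f) = ell1_functional \<phi>"
  proof (rule ell1_cdual_eqI)
    show "cdual_apply (\<Sum>f\<in>X. up_set_functional f) (ell1_delta t)
        = cdual_apply (ell1_functional \<phi>) (ell1_delta t)" for t
      using X(2) by (simp add: cdual_apply_sum_left ell1_functional_delta[of \<phi>, OF b] \<phi>_def
          subset_iff up_set_functional_idempotent_delta)
  qed
  then show ?thesis using norm_ell1_functional_le[of \<phi>, OF b] by simp
qed

text \<open>A single central element \<open>m\<close> with \<open>m \<cdot> \<delta>\<^sub>e\<close> close to \<open>\<delta>\<^sub>e\<close>, for one idempotent \<open>e\<close> of the class,
  is contradictory when the class is infinite: \<open>m\<close> takes one value at the functionals of all the
  idempotents of the class, and bounded sums of arbitrarily many of these force that value to be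
  \<open>0\<close>, whereas closeness forces it to be near \<open>1\<close>.\<close>

theorem D_class_idempotents_finite_if_ultra_central_approximate_identity:
  fixes D :: "'s::inverse_semigroup set"
  assumes ulf: "idempotents_uniformly_locally_finite TYPE('s)"
    and id: "has_ultra_central_approximate_identity TYPE('s ell1)"
    and D: "D \<in> D_classes"
  shows "finite (D \<inter> idempotents)"
proof (rule ccontr)
  assume inf: "infinite (D \<inter> idempotents)"
  obtain N where N: "\<And>e :: 's. e \<in> idempotents \<Longrightarrow>
      finite {f \<in> idempotents. idem_le f e} \<and> card {f \<in> idempotents. idem_le f e} \<le> N"
    using ulf unfolding idempotents_uniformly_locally_finite_def by blast
  obtain s where s: "D = D_rel `` {s}"
    using D unfolding D_classes_def by (auto elim: quotientE)
  define e where "e = s * star s"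
  have e: "e \<in> idempotents" by (simp add: e_def)
  obtain m :: "'s ell1 cdual cdual"
    where cen: "\<And>a. bidual_left_action a m = bidual_right_action m a"
      and close: "norm (bidual_right_action m (ell1_delta e) - canonical_embedding (ell1_delta e)) < 1"
  proof -
    obtain I :: "('s ell1 cdual cdual \<times> 's ell1 cdual cdual set) set"
        and le and u :: "_ \<Rightarrow> 's ell1 cdual cdual"
      where u: "ultra_central_approximate_identity I le u"
      using id unfolding has_ultra_central_approximate_identity_def by blast
    then have "net_tendsto I le (\<lambda>i. bidual_right_action (u i) (ell1_delta e))
        (canonical_embedding (ell1_delta e))"
      unfolding ultra_central_approximate_identity_def by blast
    then obtain i where "i \<in> I" "\<forall>j\<in>I. le i j \<longrightarrow>
        norm (bidual_right_action (u j) (ell1_delta e) - canonical_embedding (ell1_delta e)) < 1"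
      unfolding net_tendsto_def using zero_less_one by blast
    moreover have "le i i" if "i \<in> I"
      using u that unfolding ultra_central_approximate_identity_def directed_preorder_def by blast
    ultimately show thesis
      using that u unfolding ultra_central_approximate_identity_def by blast
  qed
  let ?m = "\<lambda>f. cdual_apply m (up_set_functional f)"
  have trace: "?m (star x * x) = ?m (x * star x)" for x
    using arg_cong[OF cen[of "ell1_delta x"], of "\<lambda>m. cdual_apply m (up_set_functional x)"]
    by (simp add: bidual_left_action_apply bidual_right_action_apply
        up_set_functional_times_delta delta_times_up_set_functional)
  have const: "?m f = ?m e" if "f \<in> D \<inter> idempotents" for f
  proof -
    have "(s, f) \<in> D_rel" using that s by blast
    then obtain x where "e = x * star x" "star f * f = star x * x"
      unfolding e_def D_rel_def by blast
    moreover have "star f * f = f"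
      using that by (simp add: star_idempotent) (simp add: idempotents_def)
    ultimately show ?thesis using trace[of x] by simp
  qed
  have bound: "real n * cmod (?m e) \<le> norm m * real N" for n
  proof -
    obtain X where X: "finite X" "card X = n" "X \<subseteq> D \<inter> idempotents"
      using infinite_arbitrarily_large[OF inf] by blast
    have "of_nat n * ?m e = cdual_apply m (\<Sum>f\<in>X. up_set_functional f)"
      using X const by (simp add: cdual_apply_sum subset_iff)
    then have "real n * cmod (?m e) = cmod (cdual_apply m (\<Sum>f\<in>X. up_set_functional f))"
      by (metis norm_mult norm_of_nat)
    also have "\<dots> \<le> norm m * norm (\<Sum>f\<in>X. up_set_functional f)"
      by (rule norm_cdual_apply)
    also have "\<dots> \<le> norm m * real N"
      using norm_sum_up_set_functional_le[OF X(1) _ N] X(3) by (intro mult_left_mono) auto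
    finally show ?thesis .
  qed
  have "?m e = 0"
  proof (rule ccontr)
    assume "?m e \<noteq> 0"
    then obtain n where "norm m * real N < real n * cmod (?m e)"
      using reals_Archimedean3[of "cmod (?m e)"] by auto
    with bound[of n] show False by simp
  qed
  moreover have "e * star e = e" using e by (simp add: star_idempotent) (simp add: idempotents_def)
  then have "cdual_apply (bidual_right_action m (ell1_delta e)) (up_set_functional e) = ?m e"
    using delta_times_up_set_functional[of e] by (simp add: bidual_right_action_apply)
  moreover have "cdual_apply (canonical_embedding (ell1_delta e)) (up_set_functional e) = 1"
    using e by (simp add: canonical_embedding.rep_eq up_set_functional_idempotent_delta[OF e])
      (simp add: idempotents_def)
  ultimately have "cmod (cdual_apply (bidual_right_action m (ell1_delta e)
      - canonical_embedding (ell1_delta e)) (up_set_functional e)) = 1"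
    by (simp add: minus_cdual.rep_eq)
  moreover have "norm (up_set_functional e) \<le> 1"
    unfolding up_set_functional_def by (rule norm_ell1_functional_le) simp
  ultimately show False
    using norm_cdual_apply[of "bidual_right_action m (ell1_delta e) - canonical_embedding (ell1_delta e)"
        "up_set_functional e"] close
      mult_left_mono[OF \<open>norm (up_set_functional e) \<le> 1\<close>, of
        "norm (bidual_right_action m (ell1_delta e) - canonical_embedding (ell1_delta e))"]
    by simp
qed


section \<open>Units of ideals with finitely many idempotents\<close>

lemma linear_mult_left: "linear (\<lambda>b. a * b :: 'a::real_normed_algebra)"
  and linear_mult_right: "linear (\<lambda>b. b * a :: 'a::real_normed_algebra)"
  by (rule bounded_linear.linear[OF bounded_linear_mult_right]
      bounded_linear.linear[OF bounded_linear_mult_left])+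

lemma span_delta_mult_left:
  assumes b: "b \<in> span (ell1_delta ` B)" and C: "\<And>t. t \<in> B \<Longrightarrow> s * t \<in> C"
  shows "ell1_delta s * b \<in> span (ell1_delta ` C)"
proof -
  have "ell1_delta s * b \<in> span ((\<lambda>b. ell1_delta s * b) ` ell1_delta ` B)"
    unfolding linear_span_image[OF linear_mult_left] using b by (rule imageI)
  also have "\<dots> \<subseteq> span (ell1_delta ` C)"
    using C by (intro span_mono) (auto simp: ell1_delta_times)
  finally show ?thesis .
qed

lemma span_delta_mult_right:
  assumes b: "b \<in> span (ell1_delta ` B)" and C: "\<And>t. t \<in> B \<Longrightarrow> t * s \<in> C"
  shows "b * ell1_delta s \<in> span (ell1_delta ` C)"
proof -
  have "b * ell1_delta s \<in> span ((\<lambda>b. b * ell1_delta s) ` ell1_delta ` B)"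
    unfolding linear_span_image[OF linear_mult_right] using b by (rule imageI)
  also have "\<dots> \<subseteq> span (ell1_delta ` C)"
    using C by (intro span_mono) (auto simp: ell1_delta_times)
  finally show ?thesis .
qed

definition unit_for :: "'s::semigroup_mult set \<Rightarrow> 's ell1 \<Rightarrow> bool"
  where "unit_for J u \<longleftrightarrow> (\<forall>t\<in>J. u * ell1_delta t = ell1_delta t \<and> ell1_delta t * u = ell1_delta t)"

lemma unit_for_span:
  assumes u: "unit_for J u" and b: "b \<in> span (ell1_delta ` J)"
  shows "u * b = b" "b * u = b"
proof -
  show "u * b = b"
    by (rule linear_eq_on[OF linear_mult_left linear_id[unfolded id_def] b])
      (use u in \<open>auto simp: unit_for_def\<close>)
  show "b * u = b"
    by (rule linear_eq_on[OF linear_mult_right linear_id[unfolded id_def] b])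
      (use u in \<open>auto simp: unit_for_def\<close>)
qed

text \<open>The unit is \<open>1 - \<Prod>\<^bsub>g\<in>G\<^esub> (1 - \<delta>\<^sub>g)\<close>, computed without an adjoined \<open>1\<close>: to accommodate a further
  \<open>g\<close>, replace \<open>u\<close> by \<open>u + \<delta>\<^sub>g - u \<delta>\<^sub>g\<close>. Each such step maps a norm bound \<open>b\<close> to \<open>2 b + 1\<close>.\<close>

lemma finite_semilattice_unit:
  fixes G :: "'s::inverse_semigroup set"
  assumes fin: "finite G" and G: "G \<subseteq> idempotents"
    and closed: "\<And>g h. g \<in> G \<Longrightarrow> h \<in> G \<Longrightarrow> g * h \<in> G"
  obtains u where "u \<in> span (ell1_delta ` G)" "norm u \<le> 2 ^ card G" "unit_for G u"
proof -
  have comm: "ell1_delta g * b = b * ell1_delta g" if "g \<in> G" "b \<in> span (ell1_delta ` G)" for g b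
  proof (rule linear_eq_on[OF linear_mult_left linear_mult_right that(2)])
    fix c assume "c \<in> ell1_delta ` G"
    then obtain h where h: "h \<in> G" "c = ell1_delta h" by blast
    then have "g * h = h * g" using that(1) G by (intro idempotents_commute) auto
    then show "ell1_delta g * c = c * ell1_delta g" by (simp add: h ell1_delta_times)
  qed
  \<comment> \<open>The elements of \<open>G\<close> are accommodated one at a time, but products with those treated before
    need not stay among them, so the span is taken over all of \<open>G\<close> throughout.\<close>
  have "\<exists>u\<in>span (ell1_delta ` G). norm u \<le> 2 ^ card H - 1 \<and> (\<forall>h\<in>H. u * ell1_delta h = ell1_delta h)"
    if "finite H" "H \<subseteq> G" for H
    using that
  proof (induction H rule: finite_subset_induct')
    case empty
    show ?case by (intro bexI[of _ 0]) (simp_all add: span_zero)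
  next
    case (insert g H)
    then obtain u where u: "u \<in> span (ell1_delta ` G)" "norm u \<le> 2 ^ card H - 1"
      "\<And>h. h \<in> H \<Longrightarrow> u * ell1_delta h = ell1_delta h"
      by blast
    let ?u = "u + ell1_delta g - u * ell1_delta g"
    have g: "g * g = g" using insert G by (auto simp: idempotents_def)
    have "ell1_delta g \<in> span (ell1_delta ` G)"
      using insert by (intro span_base imageI)
    then have "?u \<in> span (ell1_delta ` G)"
      using insert closed u(1)
      by (intro span_diff span_add span_delta_mult_right[OF u(1)]) auto
    moreover have "norm ?u \<le> 2 ^ card (insert g H) - 1"
    proof -
      have "norm ?u \<le> norm u + norm (ell1_delta g) + norm u * norm (ell1_delta g)"
        using norm_triangle_ineq4[of "u + ell1_delta g" "u * ell1_delta g"]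
          norm_triangle_ineq[of u "ell1_delta g"] norm_mult_ineq[of u "ell1_delta g"] by linarith
      also have "\<dots> \<le> 2 * 2 ^ card H - 1" using u(2) by simp
      finally show ?thesis using insert by simp
    qed
    moreover have "?u * ell1_delta g = ell1_delta g"
      by (simp add: algebra_simps ell1_delta_times g)
    moreover have "?u * ell1_delta h = ell1_delta h" if h: "h \<in> H" for h
    proof -
      have gh: "g * h = h * g"
        using insert h G by (intro idempotents_commute) auto
      have "u * ell1_delta (h * g) = ell1_delta (h * g)"
        using u(3)[OF h] by (simp add: ell1_delta_times[symmetric] mult.assoc[symmetric])
      then show ?thesis
        using u(3)[OF h] by (simp add: algebra_simps ell1_delta_times gh)
    qed
    ultimately show ?case by blast
  qed
  from this[OF fin order_refl] obtain u where u: "u \<in> span (ell1_delta ` G)"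
    "norm u \<le> 2 ^ card G - 1" "\<And>g. g \<in> G \<Longrightarrow> u * ell1_delta g = ell1_delta g"
    by blast
  show thesis
    using u comm[OF _ u(1)] by (intro that[of u]) (auto simp: unit_for_def)
qed

definition two_sided_ideal :: "'s::semigroup_mult set \<Rightarrow> bool"
  where "two_sided_ideal J \<longleftrightarrow> (\<forall>t\<in>J. \<forall>s. s * t \<in> J \<and> t * s \<in> J)"

text \<open>The idempotents of \<open>J\<close> determine the unit because \<open>J\<close> contains \<open>t t\<^sup>*\<close> and \<open>t\<^sup>* t\<close> along with \<open>t\<close>,
  and \<open>t = (t t\<^sup>*) t = t (t\<^sup>* t)\<close>.\<close>

lemma two_sided_ideal_unit:
  fixes J :: "'s::inverse_semigroup set"
  assumes J: "two_sided_ideal J" and fin: "finite (J \<inter> idempotents)"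
  obtains u where "u \<in> span (ell1_delta ` (J \<inter> idempotents))" "unit_for J u"
proof -
  have closed: "g * h \<in> J \<inter> idempotents" if "g \<in> J \<inter> idempotents" "h \<in> J \<inter> idempotents" for g h
    using that J idempotents_mult_closed[of g h] by (simp add: two_sided_ideal_def)
  obtain u where u: "u \<in> span (ell1_delta ` (J \<inter> idempotents))" "unit_for (J \<inter> idempotents) u"
    by (rule finite_semilattice_unit[OF fin Int_lower2 closed])
  have "unit_for J u"
    unfolding unit_for_def
  proof (intro ballI conjI)
    fix t assume t: "t \<in> J"
    have "u * ell1_delta (t * star t) = ell1_delta (t * star t)"
      "ell1_delta (star t * t) * u = ell1_delta (star t * t)"
      using u(2) J t by (simp_all add: unit_for_def two_sided_ideal_def)
    note * = arg_cong[OF this(1), of "\<lambda>b. b * ell1_delta t"]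
      arg_cong[OF this(2), of "\<lambda>b. ell1_delta t * b"]
    show "u * ell1_delta t = ell1_delta t"
      using *(1) by (simp only: mult.assoc[of u] ell1_delta_times star_laws)
    show "ell1_delta t * u = ell1_delta t"
      using *(2) by (simp only: mult.assoc[of _ _ u, symmetric] ell1_delta_times
          mult.assoc[of t "star t" t, symmetric] star_laws)
  qed
  with u(1) show thesis by (rule that)
qed

text \<open>Both \<open>\<delta>\<^sub>s u\<close> and \<open>u \<delta>\<^sub>s\<close> lie in the span of the ideal, on which \<open>u\<close> acts as a unit, so both equal
  \<open>u \<delta>\<^sub>s u\<close>.\<close>

lemma two_sided_ideal_unit_central:
  fixes J :: "'s::semigroup_mult set"
  assumes J: "two_sided_ideal J" and uJ: "u \<in> span (ell1_delta ` J)" and unit: "unit_for J u"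
  shows "a * u = u * a"
proof (rule ell1_operator_eqI[of "\<lambda>a. a * u" "\<lambda>a. u * a"])
  fix s
  have "ell1_delta s * u = u * (ell1_delta s * u)"
    using J by (intro unit_for_span(1)[OF unit, symmetric] span_delta_mult_left[OF uJ])
      (simp add: two_sided_ideal_def)
  also have "\<dots> = u * ell1_delta s"
    unfolding mult.assoc[symmetric]
    using J by (intro unit_for_span(2)[OF unit] span_delta_mult_right[OF uJ])
      (simp add: two_sided_ideal_def)
  finally show "ell1_delta s * u = u * ell1_delta s" .
qed (simp_all add: bounded_linear_mult_left bounded_linear_mult_right mult_scaleC_left mult_scaleC_right)

text \<open>The bound does not depend on \<open>J\<close>: for \<open>e = s s\<^sup>*\<close>, the element \<open>u \<delta>\<^sub>e\<close> is the unit \<open>v\<close> of the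
  semilattice of idempotents of \<open>J\<close> below \<open>e\<close>, whose size is at most \<open>N\<close>, and \<open>u \<delta>\<^sub>s = (u \<delta>\<^sub>e) \<delta>\<^sub>s\<close>.\<close>

lemma norm_two_sided_ideal_unit_mult_le:
  fixes J :: "'s::inverse_semigroup set"
  assumes J: "two_sided_ideal J" and uJ: "u \<in> span (ell1_delta ` (J \<inter> idempotents))"
    and unit: "unit_for J u"
    and N: "\<And>e :: 's. e \<in> idempotents \<Longrightarrow>
      finite {f \<in> idempotents. idem_le f e} \<and> card {f \<in> idempotents. idem_le f e} \<le> N"
  shows "norm (u * a) \<le> 2 ^ N * norm a"
proof (rule ell1_operator_norm_le[of "\<lambda>a. u * a"])
  fix s :: 's
  define e where "e = s * star s"
  define G where "G = {g \<in> J \<inter> idempotents. idem_le g e}"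
  have e: "e \<in> idempotents" by (simp add: e_def)
  have sub: "G \<subseteq> {f \<in> idempotents. idem_le f e}" by (auto simp: G_def)
  have fin: "finite G" and card: "card G \<le> N"
    using N[OF e] finite_subset[OF sub] card_mono[OF _ sub] by auto
  have closed: "g * h \<in> G" if "g \<in> G" "h \<in> G" for g h
  proof -
    have "g * h * e = g * h" using that by (simp add: G_def idem_le_def mult.assoc)
    moreover have "e * (g * h) = g * h"
      using that by (simp add: G_def idem_le_def mult.assoc[symmetric])
    ultimately show ?thesis
      using that J idempotents_mult_closed[of g h] by (simp add: G_def idem_le_def two_sided_ideal_def)
  qed
  obtain v where v: "v \<in> span (ell1_delta ` G)" "norm v \<le> 2 ^ card G" "unit_for G v"
    using finite_semilattice_unit[OF fin _ closed] by (auto simp: G_def)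
  have "u * ell1_delta e \<in> span (ell1_delta ` G)"
  proof (rule span_delta_mult_right[OF uJ])
    fix t assume t: "t \<in> J \<inter> idempotents"
    then have "e * t = t * e" using idempotents_commute e by blast
    moreover have "t * e * e = t * e" using e by (simp add: idempotents_def mult.assoc)
    ultimately show "t * e \<in> G"
      using t J e idempotents_mult_closed[of t e]
      by (simp add: G_def idem_le_def two_sided_ideal_def mult.assoc[symmetric])
  qed
  then have "u * ell1_delta e = v * (u * ell1_delta e)"
    by (rule unit_for_span(1)[OF v(3), symmetric])
  also have "\<dots> = v * ell1_delta e"
  proof -
    have "v \<in> span (ell1_delta ` J)"
      by (rule subsetD[OF span_mono v(1)]) (auto simp: G_def)
    then show ?thesis
      using unit_for_span(2)[OF unit] by (simp add: mult.assoc[symmetric])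
  qed
  also have "\<dots> = v"
    by (rule linear_eq_on[OF linear_mult_right linear_id[unfolded id_def] v(1)])
      (auto simp: G_def idem_le_def ell1_delta_times)
  finally have "v = u * ell1_delta e" ..
  moreover have "e * s = s" by (simp add: e_def star_laws)
  ultimately have "u * ell1_delta s = v * ell1_delta s"
    by (simp add: mult.assoc ell1_delta_times)
  then have "norm (u * ell1_delta s) \<le> norm v"
    using norm_mult_ineq[of v "ell1_delta s"] by simp
  also have "\<dots> \<le> 2 ^ N"
    using card by (intro order_trans[OF v(2)] power_increasing) simp_all
  finally show "norm (u * ell1_delta s) \<le> 2 ^ N" .
qed (simp_all add: bounded_linear_mult_right mult_scaleC_right)


section \<open>Finite classes give an ultra central approximate identity\<close>

text \<open>Every idempotent \<open>f = x e y\<close> of the ideal \<open>S e S\<close> is linked to an idempotent below \<open>e\<close>: for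
  \<open>z = e y f\<close> one has \<open>z\<^sup>* z = f\<close> and \<open>z z\<^sup>* \<le> e\<close>. So the idempotents of the ideal are spread over
  the classes of the finitely many idempotents below \<open>e\<close>.\<close>

lemma principal_ideal_idempotents_finite:
  fixes e :: "'s::inverse_semigroup"
  assumes e: "e \<in> idempotents" and low: "finite {f \<in> idempotents. idem_le f e}"
    and D: "\<And>D. D \<in> (D_classes :: 's set set) \<Longrightarrow> finite (D \<inter> idempotents)"
  shows "finite ({x * e * y | x y. True} \<inter> idempotents)"
proof (rule finite_subset)
  show "finite (\<Union>g\<in>{f \<in> idempotents. idem_le f e}. D_rel `` {g} \<inter> idempotents)"
    by (rule finite_UN_I[OF low]) (rule D, simp add: D_classes_def quotientI)
  show "{x * e * y | x y. True} \<inter> idempotents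
      \<subseteq> (\<Union>g\<in>{f \<in> idempotents. idem_le f e}. D_rel `` {g} \<inter> idempotents)"
  proof
    fix f assume "f \<in> {x * e * y | x y. True} \<inter> idempotents"
    then obtain x y where f: "f = x * e * y" "f \<in> idempotents" by blast
    define z where "z = e * y * f"
    have ff: "f * f = f" using f(2) by (simp add: idempotents_def)
    have xz: "x * z = f"
      using ff by (simp add: z_def f(1)[symmetric] mult.assoc[symmetric])
    have zf: "z * f = z" using ff by (simp add: z_def mult.assoc)
    have ez: "e * z = z" using e by (simp add: z_def idempotents_def mult.assoc[symmetric])
    have "f * (star z * z) = x * (z * star z * z)"
      by (simp add: xz[symmetric] mult.assoc)
    also have "\<dots> = f" by (simp add: star_laws xz)
    finally have "f = f * (star z * z)" ..
    also have "\<dots> = star z * z * f" using f(2) by (intro idempotents_commute) simp_all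
    also have "\<dots> = star z * z" by (simp add: mult.assoc zf)
    finally have fz: "f = star z * z" .
    have g: "e * (z * star z) = z * star z" by (simp add: mult.assoc[symmetric] ez)
    have "idem_le (z * star z) e"
      using g idempotents_commute[OF e range_projection_idempotent, of z] by (simp add: idem_le_def)
    moreover have "(z * star z, f) \<in> D_rel"
      unfolding D_rel_def
      using fz by (auto intro!: exI[of _ z] simp: star_idempotent star_mult mult.assoc[symmetric] star_laws)
    ultimately show "f \<in> (\<Union>g\<in>{f \<in> idempotents. idem_le f e}. D_rel `` {g} \<inter> idempotents)"
      using f(2) by (intro UN_I[of "z * star z"]) auto
  qed
qed

lemma ell1_finite_approximation:
  assumes "\<epsilon> > 0"
  obtains K where "finite K" "norm (a - (\<Sum>s\<in>K. ell1_apply a s *\<^sub>C ell1_delta s)) < \<epsilon>"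
proof -
  have "\<forall>\<^sub>F K in finite_subsets_at_top UNIV. dist (\<Sum>s\<in>K. ell1_apply a s *\<^sub>C ell1_delta s) a < \<epsilon>"
    using ell1_delta_has_sum[of a] assms unfolding has_sum_def tendsto_iff by blast
  then show thesis
    using that unfolding eventually_finite_subsets_at_top
    by (metis dist_commute dist_norm order_refl top_greatest)
qed

text \<open>The approximate identity already lies in the algebra. Its index set consists of the ideals with
  finitely many idempotents, ordered by inclusion.\<close>

theorem ultra_central_approximate_identity_if_D_class_idempotents_finite:
  assumes ulf: "idempotents_uniformly_locally_finite TYPE('s::inverse_semigroup)"
    and D: "\<And>D. D \<in> (D_classes :: 's set set) \<Longrightarrow> finite (D \<inter> idempotents)"
  shows "has_ultra_central_approximate_identity TYPE('s ell1)"
proof -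
  obtain N where N: "\<And>e :: 's. e \<in> idempotents \<Longrightarrow>
      finite {f \<in> idempotents. idem_le f e} \<and> card {f \<in> idempotents. idem_le f e} \<le> N"
    using ulf unfolding idempotents_uniformly_locally_finite_def by blast
  define I where "I = {J :: 's set. two_sided_ideal J \<and> finite (J \<inter> idempotents)}"
  have "\<forall>J\<in>I. \<exists>u. u \<in> span (ell1_delta ` (J \<inter> idempotents)) \<and> unit_for J u"
    using two_sided_ideal_unit unfolding I_def by blast
  then obtain u where u: "\<And>J. J \<in> I \<Longrightarrow> u J \<in> span (ell1_delta ` (J \<inter> idempotents))"
    "\<And>J. J \<in> I \<Longrightarrow> unit_for J (u J)"
    by metis
  have central: "a * u J = u J * a" if J: "J \<in> I" for J a
  proof (rule two_sided_ideal_unit_central[OF _ _ u(2)[OF J]])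
    show "u J \<in> span (ell1_delta ` J)"
      by (rule subsetD[OF span_mono u(1)[OF J]]) auto
  qed (use J in \<open>simp add: I_def\<close>)
  have le: "norm (u J * a) \<le> 2 ^ N * norm a" if J: "J \<in> I" for J a
    using J N by (intro norm_two_sided_ideal_unit_mult_le[OF _ u[OF J]]) (simp_all add: I_def)
  have conv: "\<exists>J0\<in>I. \<forall>J\<in>I. J0 \<subseteq> J \<longrightarrow> norm (u J * a - a) < \<epsilon>" if "\<epsilon> > 0" for \<epsilon> a
  proof -
    have pos: "2 ^ N + 1 > (0 :: real)" by (simp add: add_pos_pos)
    then obtain K where K: "finite K"
      "norm (a - (\<Sum>s\<in>K. ell1_apply a s *\<^sub>C ell1_delta s)) < \<epsilon> / (2 ^ N + 1)"
      using ell1_finite_approximation[of "\<epsilon> / (2 ^ N + 1)" a] \<open>\<epsilon> > 0\<close> by auto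
    define b where "b = (\<Sum>s\<in>K. ell1_apply a s *\<^sub>C ell1_delta s)"
    \<comment> \<open>This ideal contains the support of \<open>b\<close>, since \<open>s = (s s\<^sup>*) (s s\<^sup>*) s\<close>.\<close>
    define J0 where "J0 = (\<Union>s\<in>K. {x * (s * star s) * y | x y. True})"
    have "J0 \<inter> idempotents = (\<Union>s\<in>K. {x * (s * star s) * y | x y. True} \<inter> idempotents)"
      unfolding J0_def by blast
    moreover have "finite \<dots>"
      by (rule finite_UN_I[OF K(1) principal_ideal_idempotents_finite])
        (simp_all add: N D)
    moreover have "two_sided_ideal J0"
      unfolding two_sided_ideal_def
    proof (intro ballI allI)
      fix t r assume "t \<in> J0"
      then obtain s x y where "s \<in> K" and t: "t = x * (s * star s) * y"
        unfolding J0_def by blast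
      moreover have "r * t = (r * x) * (s * star s) * y" "t * r = x * (s * star s) * (y * r)"
        by (simp_all add: t mult.assoc)
      ultimately show "r * t \<in> J0 \<and> t * r \<in> J0" unfolding J0_def by blast
    qed
    ultimately have J0: "J0 \<in> I" by (simp add: I_def)
    have KJ0: "K \<subseteq> J0"
    proof
      fix s assume "s \<in> K"
      moreover have "s = s * star s * (s * star s) * s" by (simp add: mult.assoc[symmetric] star_laws)
      ultimately show "s \<in> J0" unfolding J0_def by blast
    qed
    have "norm (u J * a - a) < \<epsilon>" if J: "J \<in> I" "J0 \<subseteq> J" for J
    proof -
      have "u J * b = b"
        unfolding b_def sum_distrib_left mult_scaleC_right
        using u(2)[OF J(1)] KJ0 J(2) by (intro sum.cong) (auto simp: unit_for_def)
      then have "u J * a - a = u J * (a - b) - (a - b)" by (simp add: algebra_simps)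
      then have "norm (u J * a - a) \<le> norm (u J * (a - b)) + norm (a - b)"
        by (simp only: norm_triangle_ineq4)
      also have "\<dots> \<le> (2 ^ N + 1) * norm (a - b)"
        using le[OF J(1), of "a - b"] by (simp add: algebra_simps)
      also have "\<dots> < \<epsilon>"
        using K(2) pos by (simp add: b_def field_simps)
      finally show ?thesis .
    qed
    with J0 show ?thesis by blast
  qed
  have "ultra_central_approximate_identity I (\<subseteq>) (\<lambda>J. canonical_embedding (u J))"
    unfolding ultra_central_approximate_identity_def
  proof (intro conjI allI ballI)
    have "{} \<in> I" by (simp add: I_def two_sided_ideal_def)
    moreover have "J \<union> J' \<in> I" if "J \<in> I" "J' \<in> I" for J J'
      using that by (auto simp: I_def two_sided_ideal_def Int_Un_distrib2)
    ultimately show "directed_preorder I (\<subseteq>)"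
      unfolding directed_preorder_def by blast
  next
    fix a J assume "J \<in> I"
    then show "bidual_left_action a (canonical_embedding (u J))
        = bidual_right_action (canonical_embedding (u J)) a"
      by (simp add: bidual_left_action_canonical_embedding bidual_right_action_canonical_embedding central)
  next
    fix a
    show "net_tendsto I (\<subseteq>) (\<lambda>J. bidual_right_action (canonical_embedding (u J)) a)
        (canonical_embedding a)"
      unfolding net_tendsto_def bidual_right_action_canonical_embedding
      using conv norm_canonical_embedding_diff_le by (meson order_le_less_trans)
  qed
  then show ?thesis by (rule has_ultra_central_approximate_identityI)
qed


section \<open>The characterisation\<close>

theorem theorem2p6:
  assumes "idempotents_uniformly_locally_finite TYPE('s::inverse_semigroup)"
  shows "has_ultra_central_approximate_identity TYPE('s ell1) \<longleftrightarrow>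
    (\<forall>D \<in> (D_classes :: 's set set). finite (D \<inter> idempotents))"
  using D_class_idempotents_finite_if_ultra_central_approximate_identity[OF assms]
    ultra_central_approximate_identity_if_D_class_idempotents_finite[OF assms] by blast

end
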